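(* Let $\alpha,\beta>-1$, $0<p,q<\infty$, $\phi\in H(\mathbb D)$ and let $\varphi$ be an analytic self-map of $\mathbb D$. Then: (1) If $p<\alpha+2$, then $W_{\phi,\varphi}:D^p_\alpha\to D^q_\beta$ is order bounded if and only if $$\int_{\mathbb D}\frac{|\phi(z)\varphi'(z)|^q}{(1-|\varphi(z)|^2)^{q(\alpha+2)/p}}\,dA_\beta(z)+\int_{\mathbb D}\frac{|\phi'(z)|^q}{(1-|\varphi(z)|^2)^{q(\alpha+2-p)/p}}\,dA_\beta(z)<\infty.$$ (2) If $p=\alpha+2$, then $W_{\phi,\varphi}:D^p_\alpha\to D^q_\beta$ is order bounded if and only if $$\int_{\mathbb D}\frac{|\phi(z)\varphi'(z)|^q}{(1-|\varphi(z)|^2)^{q}}\,dA_\beta(z)+\int_{\mathbb D}\frac{|\phi'(z)|^q}{\left(\log\frac{2}{1-|\varphi(z)|^2}\right)^{q(1-p)/p}}\,dA_\beta(z)<\infty.$$ (3) If $p>\alpha+2$, then $W_{\phi,\varphi}:D^p_\alpha\to D^q_\beta$ is order bounded if and only if $\phi\in D^q_\beta$ and $$\int_{\mathbb D}\frac{|\phi(z)\varphi'(z)|^q}{(1-|\varphi(z)|^2)^{q(\alpha+2)/p}}\,dA_\beta(z)<\infty.$$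
   Context: $\mathbb D$ is the open unit disk, $H(\mathbb D)$ the space of analytic functions on $\mathbb D$, $dA=\frac1\pi dx\,dy$ the normalized area measure, and $dA_\beta(z)=(1-|z|^2)^\beta dA(z)$; $L^q(A_\beta)$ denotes the measurable functions $g$ on $\mathbb D$ with $\int_{\mathbb D}|g|^q dA_\beta<\infty$. For $0<p<\infty$, $\alpha>-1$, the weighted Dirichlet space $D^p_\alpha$ consists of $f\in H(\mathbb D)$ with $\|f\|_{D^p_\alpha}=\left(|f(0)|^p+\int_{\mathbb D}|f'(z)|^p(1-|z|^2)^\alpha\,dA(z)\right)^{1/p}<\infty$. For $\phi\in H(\mathbb D)$ and an analytic self-map $\varphi$ of $\mathbb D$, the weighted composition operator is $W_{\phi,\varphi}f(z)=\phi(z)f(\varphi(z))$. The operator $W_{\phi,\varphi}:D^p_\alpha\to D^q_\beta$ is called order bounded if there exists $g\in L^q(A_\beta)$ such that for every $f\in D^p_\alpha$ with $\|f\|_{D^p_\alpha}\le 1$, $|(W_{\phi,\varphi}f)'(z)|\le g(z)$ for $A_\beta$-almost every $z\in\mathbb D$. *)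

theory Defs
  imports "HOL-Analysis.Analysis"
begin

abbreviation unit_disk :: "complex set" where
  "unit_disk \<equiv> ball 0 1"

definition dA_w :: "real \<Rightarrow> complex measure" where
  "dA_w \<beta> = density (restrict_space lborel unit_disk)
              (\<lambda>z. ennreal ((1 - (cmod z)\<^sup>2) powr \<beta> / pi))"

definition finite_int :: "real \<Rightarrow> (complex \<Rightarrow> real) \<Rightarrow> bool" where
  "finite_int \<beta> F \<longleftrightarrow> (\<integral>\<^sup>+ z. ennreal (F z) \<partial>dA_w \<beta>) < \<infinity>"

definition dirichlet_space :: "real \<Rightarrow> real \<Rightarrow> (complex \<Rightarrow> complex) set" where
  "dirichlet_space p \<alpha> = {f. f holomorphic_on unit_disk \<and>
      finite_int \<alpha> (\<lambda>z. cmod (deriv f z) powr p)}"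

definition dirichlet_norm :: "real \<Rightarrow> real \<Rightarrow> (complex \<Rightarrow> complex) \<Rightarrow> real" where
  "dirichlet_norm p \<alpha> f =
     (cmod (f 0) powr p + enn2real (\<integral>\<^sup>+ z. ennreal (cmod (deriv f z) powr p) \<partial>dA_w \<alpha>))
       powr (1 / p)"

definition wcomp :: "(complex \<Rightarrow> complex) \<Rightarrow> (complex \<Rightarrow> complex) \<Rightarrow> (complex \<Rightarrow> complex) \<Rightarrow> complex \<Rightarrow> complex" where
  "wcomp u \<phi> f = (\<lambda>z. u z * f (\<phi> z))"

definition order_bounded ::
  "real \<Rightarrow> real \<Rightarrow> real \<Rightarrow> real \<Rightarrow> (complex \<Rightarrow> complex) \<Rightarrow> (complex \<Rightarrow> complex) \<Rightarrow> bool" where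
  "order_bounded p \<alpha> q \<beta> u \<phi> \<longleftrightarrow>
     (\<exists>g :: complex \<Rightarrow> real. g \<in> borel_measurable (dA_w \<beta>) \<and>
        finite_int \<beta> (\<lambda>z. \<bar>g z\<bar> powr q) \<and>
        (\<forall>f \<in> dirichlet_space p \<alpha>. dirichlet_norm p \<alpha> f \<le> 1 \<longrightarrow>
            (AE z in dA_w \<beta>. cmod (deriv (wcomp u \<phi> f) z) \<le> g z)))"

end

theory Submission
  imports Defs "HOL-Complex_Analysis.Cauchy_Integral_Formula"
begin

text \<open>
  Order boundedness amounts to the finiteness of the integral of the \<open>q\<close>-th power of the
  supremum of \<open>\<bar>(W f)' z\<bar>\<close> over the unit ball, where \<open>(W f)' z = u' z * f w + u z * \<phi>' z * f' w\<close>
  at \<open>w = \<phi> z\<close>. Hence everything rests on sharp growth estimates for \<open>f w\<close> and \<open>f' w\<close>. With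
  \<open>\<delta> = 1 - \<bar>w\<bar>\<^sup>2\<close> and \<open>s = (\<alpha> + 2) / p\<close>, the derivative grows like \<open>\<delta> powr (- s)\<close>, by a local
  area estimate, and the function like \<open>\<delta> powr (1 - s)\<close>, \<open>ln (2 / \<delta>) powr (1 - 1 / p)\<close> or a constant.
  Conversely these rates are attained by the normalized kernels
  \<open>\<delta> powr (M + 1 - s) / (1 - cnj w * z) ^ M\<close> and, in the critical case \<open>s = 1\<close>, by
  \<open>ln (2 / \<delta>) powr (- 1 / p) * ln (2 / (1 - cnj w * z))\<close>; comparing the kernels for \<open>M\<close> and \<open>M + 1\<close>
  separates the two terms of \<open>(W f)' z\<close>.
\<close>

section \<open>Weighted area measure near the boundary\<close>

text \<open>The exponent \<open>\<alpha> + 2\<close> has one geometric source. A ball of radius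
  \<open>\<rho>\<close> centred on the unit circle has \<open>dA_w \<alpha>\<close>-measure at most
  a multiple of \<open>\<rho> powr (\<alpha> + 2)\<close>, while a ball about \<open>w\<close> of
  radius proportional to \<open>1 - cmod w\<close> has measure at least a multiple of
  \<open>\<delta> powr (\<alpha> + 2)\<close>. The lower bound limits the growth of derivatives, the
  upper bound limits the energy of the kernels, and so both meet at the same rate. The kernel of
  order \<open>M\<close> has a derivative of order \<open>M + 1\<close>, whose \<open>p\<close>-th
  power is in the convergent range as soon as \<open>M + 1 > s\<close>; such \<open>M\<close> exist
  for every \<open>s\<close>, so the power kernels serve in all three cases. Evaluated at their own
  parameter they give a function term independent of \<open>M\<close> and a derivative term
  proportional to \<open>M\<close>, which is why two consecutive orders suffice. The critical case
  has a single logarithmic kernel; its derivative term is already controlled by the power kernels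
  and is subtracted.\<close>

lemma powr_comparable:
  fixes x y c a :: real
  assumes "0 < x" "0 < y" "x \<le> c * y" "y \<le> c * x"
  shows "x powr a \<le> c powr \<bar>a\<bar> * y powr a"
proof -
  have c: "c > 0" using assms by (metis less_le_trans zero_less_mult_pos2)
  show ?thesis
  proof (cases "a \<ge> 0")
    case True
    have "x powr a \<le> (c * y) powr a" using assms True by (intro powr_mono2) auto
    then show ?thesis using True c assms by (simp add: powr_mult)
  next
    case False
    have "x powr a \<le> (y / c) powr a"
      using assms False c by (intro powr_mono2') (auto simp: field_simps)
    also have "\<dots> = c powr \<bar>a\<bar> * y powr a"
      using False c assms by (simp add: powr_divide powr_minus divide_simps)
    finally show ?thesis .
  qed
qed

lemma space_dA_w [simp]: "space (dA_w \<beta>) = unit_disk"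
  by (simp add: dA_w_def space_restrict_space)

lemma sets_dA_w: "sets (dA_w \<beta>) = sets (restrict_space borel unit_disk)"
  by (simp add: dA_w_def sets_restrict_space)

lemma sets_dA_wI: "S \<in> sets borel \<Longrightarrow> S \<subseteq> unit_disk \<Longrightarrow> S \<in> sets (dA_w \<beta>)"
  by (auto simp: sets_dA_w sets_restrict_space)

lemma measurable_dA_w_continuous:
  fixes f :: "complex \<Rightarrow> 'a::topological_space"
  assumes "continuous_on unit_disk f"
  shows "f \<in> borel_measurable (dA_w \<beta>)"
  using borel_measurable_continuous_on_restrict[OF assms]
  by (subst measurable_cong_sets[OF sets_dA_w refl])

lemma measurable_weight:
  "(\<lambda>z. ennreal ((1 - (cmod z)\<^sup>2) powr \<beta> / pi)) \<in> borel_measurable (restrict_space lborel unit_disk)"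
  by (intro measurable_restrict_space1) measurable

lemma emeasure_dA_w:
  assumes "S \<in> sets borel" "S \<subseteq> unit_disk"
  shows "emeasure (dA_w \<beta>) S
    = (\<integral>\<^sup>+ z. ennreal ((1 - (cmod z)\<^sup>2) powr \<beta> / pi) * indicator S z \<partial>lborel)"
proof -
  have S: "S \<in> sets (restrict_space lborel unit_disk)"
    using assms by (auto simp: sets_restrict_space)
  have eq: "indicator S z * indicator unit_disk z = (indicator S z :: ennreal)" for z
    using assms by (auto simp: indicator_def)
  show ?thesis
    unfolding dA_w_def
    by (subst emeasure_density[OF measurable_weight S], subst nn_integral_restrict_space)
       (auto simp: mult.assoc eq)
qed

lemma emeasure_dA_w_le:
  assumes "S \<in> sets borel" "S \<subseteq> unit_disk"
    and "\<And>z. z \<in> S \<Longrightarrow> (1 - (cmod z)\<^sup>2) powr \<beta> \<le> m"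
  shows "emeasure (dA_w \<beta>) S \<le> ennreal (m / pi) * emeasure lborel S"
proof -
  have "emeasure (dA_w \<beta>) S \<le> (\<integral>\<^sup>+ z. ennreal (m / pi) * indicator S z \<partial>lborel)"
    unfolding emeasure_dA_w[OF assms(1,2)]
    by (intro nn_integral_mono) (auto simp: indicator_def intro!: ennreal_leI divide_right_mono assms(3))
  then show ?thesis using assms(1) by (simp add: nn_integral_cmult_indicator)
qed

lemma emeasure_dA_w_ge:
  assumes "S \<in> sets borel" "S \<subseteq> unit_disk"
    and "\<And>z. z \<in> S \<Longrightarrow> m \<le> (1 - (cmod z)\<^sup>2) powr \<beta>"
  shows "ennreal (m / pi) * emeasure lborel S \<le> emeasure (dA_w \<beta>) S"
proof -
  have "(\<integral>\<^sup>+ z. ennreal (m / pi) * indicator S z \<partial>lborel) \<le> emeasure (dA_w \<beta>) S"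
    unfolding emeasure_dA_w[OF assms(1,2)]
    by (intro nn_integral_mono) (auto simp: indicator_def intro!: ennreal_leI divide_right_mono assms(3))
  then show ?thesis using assms(1) by (simp add: nn_integral_cmult_indicator)
qed

lemma emeasure_complex_ball:
  assumes "r \<ge> 0"
  shows "emeasure lborel (ball (c::complex) r) = ennreal (pi * r\<^sup>2)"
  using emeasure_ball[OF assms, of c] by (simp add: unit_ball_vol_2)

lemma one_minus_cmod_bounds:
  assumes "cmod w \<le> 1"
  shows "1 - cmod w \<le> 1 - (cmod w)\<^sup>2" "1 - (cmod w)\<^sup>2 \<le> 2 * (1 - cmod w)"
proof -
  have "1 - (cmod w)\<^sup>2 = (1 - cmod w) * (1 + cmod w)" by (simp add: power2_eq_square algebra_simps)
  moreover have "(1 - cmod w) * (1 + cmod w) \<le> (1 - cmod w) * 2"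
    using assms by (intro mult_left_mono) auto
  moreover have "(1 - cmod w) * 1 \<le> (1 - cmod w) * (1 + cmod w)"
    using assms by (intro mult_left_mono) auto
  ultimately show "1 - cmod w \<le> 1 - (cmod w)\<^sup>2" "1 - (cmod w)\<^sup>2 \<le> 2 * (1 - cmod w)"
    by (auto simp: algebra_simps)
qed

section \<open>Measure of balls centred on the unit circle\<close>

text \<open>Close to \<open>1\<close>, \<open>Ln\<close> recovers \<open>t\<close> from
  \<open>cis t\<close> and at most doubles the distance to \<open>1\<close>. Farther away the
  trivial bound \<open>pi\<close> suffices, and the factor \<open>2 * pi\<close> is what this case
  needs at distance \<open>1/2\<close>.\<close>

lemma abs_le_cmod_cis_minus_1:
  assumes "-pi < t" "t \<le> pi"
  shows "\<bar>t\<bar> \<le> 2 * pi * cmod (cis t - 1)"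
proof (cases "cmod (cis t - 1) < 1/2")
  case True
  have "Ln (1 + (cis t - 1)) = \<i> * of_real t"
    using assms by (simp add: cis_conv_exp Ln_exp)
  with norm_Ln_le[of "cis t - 1"] True have "\<bar>t\<bar> \<le> 2 * cmod (cis t - 1)"
    by (simp add: norm_mult)
  also have "\<dots> \<le> 2 * pi * cmod (cis t - 1)"
    using pi_gt3 by (intro mult_right_mono) auto
  finally show ?thesis .
next
  case False
  have "\<bar>t\<bar> \<le> pi" using assms by auto
  also have "pi \<le> 2 * pi * cmod (cis t - 1)" using False pi_gt3 by (simp add: field_simps)
  finally show ?thesis .
qed

lemma dist_cis_le: "cmod (cis a - cis b) \<le> \<bar>a - b\<bar>"
proof -
  have "cis a - cis b = cis b * (cis (a - b) - 1)" by (simp add: algebra_simps cis_mult)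
  then have "cmod (cis a - cis b) = cmod (cis (a - b) - 1)" by (simp add: norm_mult)
  also have "\<dots> \<le> \<bar>a - b\<bar>"
    using dist_exp_i_1[of "a-b"] abs_sin_x_le_abs_x[of "(a-b)/2"] by (simp add: cis_conv_exp dist_norm)
  finally show ?thesis .
qed

text \<open>After rotating \<open>\<zeta>\<close> to \<open>1\<close>, a point of the arc is known
  up to \<open>h\<close> from its angle, since its modulus is within \<open>h\<close> of
  \<open>1\<close>. Rounding the angle to a multiple of \<open>h\<close> costs another
  \<open>h / 2\<close>, and the angle itself is at most a multiple of \<open>\<rho>\<close>.\<close>

lemma thin_arc_covering:
  fixes h \<rho> :: real
  assumes "cmod \<zeta> = 1" "0 < h" "h \<le> \<rho>" and z: "z \<in> unit_disk" "dist \<zeta> z < \<rho>" "1 - h \<le> cmod z"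
  shows "\<exists>k::int. \<bar>k\<bar> \<le> \<lfloor>14 * \<rho> / h\<rfloor> \<and> z \<in> ball (\<zeta> * cis (k * h)) (2 * h)"
proof -
  define v where "v = z * cnj \<zeta>"
  define t where "t = Arg v"
  define k where "k = round (t / h)"
  have zz: "\<zeta> * cnj \<zeta> = 1" using assms(1) by (simp add: complex_norm_square[symmetric])
  have zv: "z = \<zeta> * v" unfolding v_def using zz by (simp add: algebra_simps)
  have cv: "cmod v = cmod z" using assms(1) by (simp add: v_def norm_mult)
  have vt: "v = of_real (cmod z) * cis t"
    using Arg_eq[of v] by (cases "v = 0") (auto simp: t_def cv[symmetric] cis_conv_exp mult.commute)
  have "v - 1 = (z - \<zeta>) * cnj \<zeta>" using zz by (simp add: v_def algebra_simps)
  then have v1: "cmod (v - 1) < \<rho>" using assms(1) z(2) by (simp add: norm_mult dist_norm norm_minus_commute)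
  have "cis t - v = of_real (1 - cmod z) * cis t" using vt by (simp add: algebra_simps)
  then have "cmod (cis t - v) = \<bar>1 - cmod z\<bar>" by (simp only: norm_mult norm_of_real norm_cis mult_1_right)
  then have cv2: "cmod (cis t - v) \<le> h" using z by simp
  have "cmod (cis t - 1) \<le> h + \<rho>"
    using norm_triangle_ineq[of "cis t - v" "v - 1"] cv2 v1 by simp
  also have "\<dots> \<le> 2 * \<rho>" using assms by simp
  finally have "\<bar>t\<bar> \<le> 2 * pi * (2 * \<rho>)"
    using abs_le_cmod_cis_minus_1[of t] Arg_bounded[of v] unfolding t_def
    by (smt (verit) mult_left_mono pi_gt_zero)
  also have "\<dots> \<le> 13 * \<rho>" using pi_approx(2) assms by (simp add: mult_right_mono) 
  finally have t: "\<bar>t\<bar> \<le> 13 * \<rho>" .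
  have k: "\<bar>t / h - k\<bar> \<le> 1/2" using of_int_round_abs_le[of "t/h"] by (simp add: k_def abs_minus_commute)
  then have kt: "\<bar>t - k * h\<bar> \<le> h / 2"
    using assms(2) by (simp add: field_simps abs_if split: if_splits)
  have "\<bar>t\<bar> / h \<le> 13 * \<rho> / h" using t assms by (simp add: divide_right_mono)
  \<comment> \<open>This absorbs the rounding error \<open>1/2\<close>, turning the factor
    \<open>13\<close> (an upper bound of \<open>4 * pi\<close>) into \<open>14\<close>.\<close>
  moreover have "\<rho> / h \<ge> 1" using assms by simp
  moreover have "\<bar>real_of_int k\<bar> \<le> \<bar>t / h\<bar> + 1/2" using k by arith
  then have "\<bar>real_of_int k\<bar> \<le> \<bar>t\<bar> / h + 1/2" using assms by simp
  moreover have "13 * \<rho> / h = 13 * (\<rho> / h)" "14 * \<rho> / h = 14 * (\<rho> / h)" by simp_all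
  ultimately have "\<bar>real_of_int k\<bar> \<le> 14 * \<rho> / h" by linarith
  then have "\<bar>k\<bar> \<le> \<lfloor>14 * \<rho> / h\<rfloor>" by (simp add: le_floor_iff)
  moreover have "z \<in> ball (\<zeta> * cis (k * h)) (2 * h)"
  proof -
    have "\<zeta> * cis (k * h) - z = \<zeta> * (cis (k*h) - v)" by (simp add: zv algebra_simps)
    then have "dist (\<zeta> * cis (k * h)) z = cmod (cis (k*h) - v)"
      using assms(1) by (simp add: dist_norm norm_mult)
    also have "\<dots> \<le> cmod (cis (k*h) - cis t) + cmod (cis t - v)"
      using norm_triangle_ineq[of "cis (k*h) - cis t" "cis t - v"] by simp
    also have "\<dots> \<le> h/2 + h" using dist_cis_le[of "k*h" t] kt cv2 by (auto simp: abs_minus_commute)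
    also have "\<dots> < 2 * h" using assms by simp
    finally show ?thesis by simp
  qed
  ultimately show ?thesis by blast
qed

text \<open>At most \<open>29 * (\<rho> / h)\<close> balls of area \<open>4 * pi * h * h\<close>
  cover the arc, and \<open>116 = 29 * 4\<close>. The bound is linear in the thickness
  \<open>h\<close>; the area of the whole ball of radius \<open>\<rho>\<close> would lose this
  factor, which later compensates a weight singular at the circle.\<close>

lemma emeasure_thin_arc:
  assumes "cmod \<zeta> = 1" "0 < h" "h \<le> \<rho>"
  shows "emeasure lborel {z \<in> unit_disk. dist \<zeta> z < \<rho> \<and> 1 - h \<le> cmod z} \<le> ennreal (116 * pi * h * \<rho>)"
proof -
  define m where "m = \<lfloor>14 * \<rho> / h\<rfloor>"
  have m: "m \<ge> 0" "real_of_int m \<le> 14 * \<rho> / h" using assms by (auto simp: m_def)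
  let ?B = "\<lambda>k::int. ball (\<zeta> * cis (k * h)) (2 * h)"
  have "emeasure lborel {z \<in> unit_disk. dist \<zeta> z < \<rho> \<and> 1 - h \<le> cmod z}
      \<le> emeasure lborel (\<Union>k\<in>{-m..m}. ?B k)"
  proof (rule emeasure_mono)
    show "{z \<in> unit_disk. dist \<zeta> z < \<rho> \<and> 1 - h \<le> cmod z} \<subseteq> (\<Union>k\<in>{-m..m}. ?B k)"
    proof
      fix z assume "z \<in> {z \<in> unit_disk. dist \<zeta> z < \<rho> \<and> 1 - h \<le> cmod z}"
      then obtain k :: int where "\<bar>k\<bar> \<le> m" "z \<in> ?B k"
        using thin_arc_covering[OF assms, of z] unfolding m_def by auto
      then show "z \<in> (\<Union>k\<in>{-m..m}. ?B k)" by (intro UN_I[of k]) auto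
    qed
  qed (auto intro!: borel_open)
  also have "\<dots> \<le> (\<Sum>k\<in>{-m..m}. emeasure lborel (?B k))"
    by (intro emeasure_subadditive_finite) auto
  also have "\<dots> = (\<Sum>k\<in>{-m..m}. ennreal (pi * (2*h)\<^sup>2))"
    using assms by (intro sum.cong refl emeasure_complex_ball) auto
  also have "\<dots> = ennreal ((2 * m + 1) * (pi * (2*h)\<^sup>2))"
    using m by (simp add: ennreal_mult' ennreal_of_nat_eq_real_of_nat)
  also have "\<dots> \<le> ennreal (29 * (\<rho> / h) * (pi * (2*h)\<^sup>2))"
  proof (intro ennreal_leI mult_right_mono)
    have "\<rho> / h \<ge> 1" using assms by simp
    moreover from m have "real_of_int m \<le> 14 * (\<rho> / h)" by simp
    ultimately have "2 * real_of_int m + 1 \<le> 29 * (\<rho> / h)" by linarith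
    then show "real_of_int (2 * m + 1) \<le> 29 * (\<rho> / h)" by simp
  qed auto
  also have "29 * (\<rho> / h) * (pi * (2*h)\<^sup>2) = 116 * pi * h * \<rho>"
    using assms by (simp add: power2_eq_square)
  finally show ?thesis .
qed

lemma dyadic_layer:
  fixes x \<rho> :: real
  assumes "0 < x" "x \<le> \<rho>"
  obtains j where "x \<le> \<rho> / 2 ^ j" "\<rho> / 2 ^ Suc j < x"
proof -
  obtain n where "\<rho> / x < 2 ^ n" using real_arch_pow[of 2 "\<rho>/x"] by auto
  then have "\<rho> / 2 ^ n < x" using assms by (simp add: field_simps)
  moreover have "\<rho> / 2 ^ Suc n \<le> \<rho> / 2 ^ n" using assms by (simp add: field_simps)
  ultimately have ex: "\<rho> / 2 ^ Suc n < x" by linarith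
  define j where "j = (LEAST j. \<rho> / 2 ^ Suc j < x)"
  have "\<rho> / 2 ^ Suc j < x" unfolding j_def by (rule LeastI[where P="\<lambda>j. \<rho> / 2 ^ Suc j < x", OF ex])
  moreover have "x \<le> \<rho> / 2 ^ j"
  proof (cases j)
    case (Suc i)
    then have "\<not> \<rho> / 2 ^ Suc i < x" using not_less_Least[of i "\<lambda>j. \<rho> / 2 ^ Suc j < x"] by (simp add: j_def)
    then show ?thesis using Suc by simp
  qed (use assms in auto)
  ultimately show thesis using that by blast
qed

text \<open>For negative \<open>\<alpha>\<close> the weight is unbounded near the circle, so the
  ball is cut into layers on which \<open>1 - cmod z\<close> is about \<open>\<rho> / 2 ^ j\<close>
  and the weight is almost constant. By the thin arc bound the contributions form a geometric
  series, whose ratio \<open>x\<close> is below \<open>1\<close> because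
  \<open>\<alpha> > -1\<close>.\<close>

lemma emeasure_dA_w_boundary_ball:
  assumes "\<alpha> > -1"
  obtains C where "C > 0"
    "\<And>\<zeta> \<rho>. cmod \<zeta> = 1 \<Longrightarrow> 0 < \<rho> \<Longrightarrow>
       emeasure (dA_w \<alpha>) (unit_disk \<inter> ball \<zeta> \<rho>) \<le> ennreal (C * \<rho> powr (\<alpha> + 2))"
proof -
  define x :: real where "x = 2 powr (-(\<alpha> + 1))"
  have x: "0 < x" "x < 1" using assms powr_less_mono[of "-(\<alpha>+1)" 0 2] by (auto simp: x_def)
  \<comment> \<open>The \<open>pi\<close> of the thin arc bound cancels against the normalization of
    the area; the power of \<open>2\<close> pays for replacing the weight on a layer by
    \<open>h powr \<alpha>\<close>.\<close>
  define C0 :: real where "C0 = 116 * 2 powr \<bar>\<alpha>\<bar>"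
  have C0: "C0 > 0" by (simp add: C0_def)
  show thesis
  proof (rule that[of "C0 / (1 - x)"])
    show "C0 / (1 - x) > 0" using C0 x by simp
    fix \<zeta> :: complex and \<rho> :: real assume z: "cmod \<zeta> = 1" "0 < \<rho>"
    define E where "E j = {z \<in> unit_disk \<inter> ball \<zeta> \<rho>. 1 - cmod z \<le> \<rho> / 2 ^ j \<and> \<rho> / 2 ^ Suc j < 1 - cmod z}" for j
    have Eb: "E j \<in> sets borel" for j unfolding E_def by measurable
    have ED: "E j \<subseteq> unit_disk" for j unfolding E_def by auto
    have eq: "unit_disk \<inter> ball \<zeta> \<rho> = (\<Union>j. E j)"
    proof (intro equalityI subsetI)
      fix v assume v: "v \<in> unit_disk \<inter> ball \<zeta> \<rho>"
      then have "1 - cmod v \<le> \<rho>" "0 < 1 - cmod v"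
        using z norm_triangle_ineq2[of \<zeta> v] by (auto simp: dist_norm)
      then obtain j where "1 - cmod v \<le> \<rho> / 2 ^ j" "\<rho> / 2 ^ Suc j < 1 - cmod v"
        using dyadic_layer by blast
      then show "v \<in> (\<Union>j. E j)" using v unfolding E_def by blast
    qed (auto simp: E_def)
    have Ej: "emeasure (dA_w \<alpha>) (E j) \<le> ennreal (C0 * \<rho> powr (\<alpha> + 2) * x ^ j)" for j
    proof -
      define h where "h = \<rho> / 2 ^ j"
      have h: "0 < h" "h \<le> \<rho>" using z by (auto simp: h_def field_simps)
      have "emeasure (dA_w \<alpha>) (E j) \<le> ennreal (2 powr \<bar>\<alpha>\<bar> * h powr \<alpha> / pi) * emeasure lborel (E j)"
      proof (rule emeasure_dA_w_le[OF Eb ED])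
        fix v assume v: "v \<in> E j"
        then have "1 - cmod v \<le> h" "h < 2 * (1 - cmod v)" by (auto simp: E_def h_def)
        with one_minus_cmod_bounds[of v] v h ED[of j]
        show "(1 - (cmod v)\<^sup>2) powr \<alpha> \<le> 2 powr \<bar>\<alpha>\<bar> * h powr \<alpha>"
          by (intro powr_comparable) auto
      qed
      also have "emeasure lborel (E j) \<le> emeasure lborel {z \<in> unit_disk. dist \<zeta> z < \<rho> \<and> 1 - h \<le> cmod z}"
        by (rule emeasure_mono) (auto simp: E_def h_def)
      also have "\<dots> \<le> ennreal (116 * pi * h * \<rho>)"
        by (rule emeasure_thin_arc[OF z(1) h])
      also have "ennreal (2 powr \<bar>\<alpha>\<bar> * h powr \<alpha> / pi) * ennreal (116 * pi * h * \<rho>)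
          = ennreal (C0 * (h powr (\<alpha> + 1) * \<rho>))"
        using h z by (subst ennreal_mult'[symmetric]) (auto simp: C0_def powr_add)
      also have "h powr (\<alpha> + 1) * \<rho> = \<rho> powr (\<alpha> + 2) * x ^ j"
      proof -
        have "x ^ j = (1 / 2 ^ j) powr (\<alpha> + 1)"
          by (simp add: x_def powr_divide powr_powr powr_minus divide_simps
              flip: powr_realpow) (simp add: algebra_simps flip: powr_add)
        then have "h powr (\<alpha> + 1) = \<rho> powr (\<alpha> + 1) * x ^ j"
          using z by (simp add: h_def powr_divide)
        moreover have "\<rho> powr (\<alpha> + 2) = \<rho> powr (\<alpha> + 1) * \<rho>"
          using z powr_add[of \<rho> "\<alpha>+1" 1] by (simp add: add.assoc)
        ultimately show ?thesis by simp
      qed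
      finally show ?thesis by (simp add: mult.assoc mult_left_mono)
    qed
    have "emeasure (dA_w \<alpha>) (unit_disk \<inter> ball \<zeta> \<rho>) \<le> (\<Sum>j. emeasure (dA_w \<alpha>) (E j))"
      unfolding eq by (rule emeasure_subadditive_countably) (use sets_dA_wI Eb ED in auto)
    also have "\<dots> \<le> (\<Sum>j. ennreal (C0 * \<rho> powr (\<alpha> + 2) * x ^ j))"
      by (intro suminf_le Ej) auto
    also have "\<dots> = ennreal (\<Sum>j. C0 * \<rho> powr (\<alpha> + 2) * x ^ j)"
      using C0 x by (intro suminf_ennreal2) (auto intro!: summable_mult summable_geometric)
    also have "(\<Sum>j. C0 * \<rho> powr (\<alpha> + 2) * x ^ j) = C0 / (1 - x) * \<rho> powr (\<alpha> + 2)"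
      using x by (simp add: suminf_mult suminf_geometric summable_geometric)
    finally show "emeasure (dA_w \<alpha>) (unit_disk \<inter> ball \<zeta> \<rho>) \<le> ennreal (C0 / (1 - x) * \<rho> powr (\<alpha> + 2))" .
  qed
qed

lemma emeasure_dA_w_disk_finite:
  assumes "\<alpha> > -1"
  shows "emeasure (dA_w \<alpha>) unit_disk < \<infinity>"
proof -
  obtain C where C: "\<And>\<zeta> \<rho>. cmod \<zeta> = 1 \<Longrightarrow> 0 < \<rho> \<Longrightarrow>
       emeasure (dA_w \<alpha>) (unit_disk \<inter> ball \<zeta> \<rho>) \<le> ennreal (C * \<rho> powr (\<alpha> + 2))"
    using emeasure_dA_w_boundary_ball[OF assms] by blast
  have "dist 1 z < 2" if "cmod z < 1" for z :: complex
    using norm_triangle_ineq4[of 1 z] that by (simp add: dist_norm)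
  then have "unit_disk \<inter> ball 1 2 = unit_disk" by auto
  with C[of 1 2] show ?thesis by (auto intro: le_less_trans)
qed

section \<open>Integrals of negative powers of the kernel\<close>

lemma one_minus_cnj_mult_bounds:
  assumes "w \<in> unit_disk" "z \<in> unit_disk"
  shows "1 - cmod w \<le> cmod (1 - cnj w * z)" "(1 - (cmod w)\<^sup>2) / 2 \<le> cmod (1 - cnj w * z)"
    "cmod (1 - cnj w * z) < 2"
proof -
  have "cmod w * cmod z \<le> cmod w * 1" using assms by (intro mult_left_mono) auto
  then have le: "cmod (cnj w * z) \<le> cmod w" by (simp add: norm_mult)
  then show 1: "1 - cmod w \<le> cmod (1 - cnj w * z)"
    using norm_triangle_ineq2[of 1 "cnj w * z"] by simp
  show "(1 - (cmod w)\<^sup>2) / 2 \<le> cmod (1 - cnj w * z)"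
    using 1 one_minus_cmod_bounds[of w] assms by simp
  show "cmod (1 - cnj w * z) < 2"
    using norm_triangle_ineq4[of 1 "cnj w * z"] le assms by simp
qed

lemma unit_direction:
  fixes w :: complex
  obtains \<zeta> where "cmod \<zeta> = 1" "w = of_real (cmod w) * \<zeta>"
proof (cases "w = 0")
  case False
  then have "w = of_real (cmod w) * sgn w" by (simp add: sgn_div_norm scaleR_conv_of_real)
  moreover have "cmod (sgn w) = 1" using False by (simp add: norm_sgn)
  ultimately show thesis by (intro that)
qed (use that[of 1] in auto)

text \<open>For \<open>\<zeta>\<close> on the circle,
  \<open>dist \<zeta> z = cmod (1 - cnj \<zeta> * z)\<close>. Replacing \<open>\<zeta>\<close> by
  \<open>w\<close> costs at most \<open>1 - cmod w\<close>, which is itself at most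
  \<open>cmod (1 - cnj w * z)\<close>; hence the doubled radius.\<close>

lemma kernel_sublevel_subset:
  assumes "w \<in> unit_disk" "cmod \<zeta> = 1" "w = of_real (cmod w) * \<zeta>"
  shows "{z \<in> unit_disk. cmod (1 - cnj w * z) < r} \<subseteq> unit_disk \<inter> ball \<zeta> (2 * r)"
proof
  fix z assume "z \<in> {z \<in> unit_disk. cmod (1 - cnj w * z) < r}"
  then have z: "z \<in> unit_disk" "cmod (1 - cnj w * z) < r" by auto
  have "\<zeta> * cnj \<zeta> = 1" using assms(2) by (simp add: complex_norm_square[symmetric])
  then have "\<zeta> - z = \<zeta> * (1 - cnj \<zeta> * z)" by (simp add: algebra_simps)
  then have "dist \<zeta> z = cmod (1 - cnj \<zeta> * z)" using assms by (simp add: dist_norm norm_mult)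
  also have "1 - cnj \<zeta> * z = (1 - cnj w * z) - of_real (1 - cmod w) * (cnj \<zeta> * z)"
    by (subst assms(3)) (simp add: algebra_simps)
  also have "cmod \<dots> \<le> cmod (1 - cnj w * z) + (1 - cmod w) * cmod z"
    by (rule order_trans[OF norm_triangle_ineq4]) (use assms in \<open>simp add: norm_mult flip: of_real_diff\<close>)
  also have "(1 - cmod w) * cmod z \<le> 1 - cmod w"
    using z assms by (intro mult_left_le) auto
  also have "cmod (1 - cnj w * z) + (1 - cmod w) < 2 * r"
    using one_minus_cnj_mult_bounds(1)[OF assms(1) z(1)] z(2) by linarith
  finally show "z \<in> unit_disk \<inter> ball \<zeta> (2 * r)" using z by auto
qed

text \<open>The disk is split according to the size of \<open>1 - cnj w * z\<close> at the scales
  \<open>2 ^ k * \<delta>\<close>; the condition on \<open>K\<close> lifts the last scale to the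
  upper bound \<open>2\<close>. Scale \<open>k\<close> contributes a multiple of
  \<open>(2 ^ k * \<delta>) powr (\<alpha> + 2 - t)\<close>. The sum is left unevaluated because its
  ratio is below \<open>1\<close> in one application and equal to \<open>1\<close> in the
  other.\<close>

lemma kernel_integral_dyadic:
  assumes "\<alpha> > -1" "t \<ge> 0"
  obtains C where "C > 0"
    "\<And>w K. w \<in> unit_disk \<Longrightarrow> 2 \<le> 2 ^ K * (1 - (cmod w)\<^sup>2) \<Longrightarrow>
      (\<integral>\<^sup>+ z. ennreal (cmod (1 - cnj w * z) powr (-t)) \<partial>dA_w \<alpha>)
      \<le> ennreal (C * (1 - (cmod w)\<^sup>2) powr (\<alpha> + 2 - t) * (\<Sum>k\<le>K. (2 powr (\<alpha> + 2 - t)) ^ k))"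
proof -
  obtain C1 where C1: "C1 > 0" "\<And>\<zeta> \<rho>. cmod \<zeta> = 1 \<Longrightarrow> 0 < \<rho> \<Longrightarrow>
       emeasure (dA_w \<alpha>) (unit_disk \<inter> ball \<zeta> \<rho>) \<le> ennreal (C1 * \<rho> powr (\<alpha> + 2))"
    using emeasure_dA_w_boundary_ball[OF assms(1)] by blast
  \<comment> \<open>The doubled radius of the boundary ball gives
    \<open>2 powr (\<alpha> + 2)\<close>, the lower bound by half a scale gives
    \<open>2 powr t\<close>.\<close>
  define C where "C = C1 * 2 powr (\<alpha> + 2 + t)"
  show thesis
  proof (rule that[of C])
    show "C > 0" using C1 by (simp add: C_def)
    fix w K assume w: "w \<in> unit_disk" and K: "2 \<le> 2 ^ K * (1 - (cmod w)\<^sup>2)"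
    define \<delta> where "\<delta> = 1 - (cmod w)\<^sup>2"
    have \<delta>: "\<delta> > 0" using one_minus_cmod_bounds[of w] w by (simp add: \<delta>_def)
    obtain \<zeta> where \<zeta>: "cmod \<zeta> = 1" "w = of_real (cmod w) * \<zeta>" by (rule unit_direction)
    define S where "S k = {z \<in> unit_disk. cmod (1 - cnj w * z) < 2 ^ k * \<delta>}" for k :: nat
    have Sb: "S k \<in> sets (dA_w \<alpha>)" for k
      unfolding S_def by (rule sets_dA_wI) (measurable, auto)
    have Sm: "emeasure (dA_w \<alpha>) (S k) \<le> ennreal (C1 * (2 * (2 ^ k * \<delta>)) powr (\<alpha> + 2))" for k
    proof -
      have "emeasure (dA_w \<alpha>) (S k) \<le> emeasure (dA_w \<alpha>) (unit_disk \<inter> ball \<zeta> (2 * (2 ^ k * \<delta>)))"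
        unfolding S_def
        by (rule emeasure_mono[OF kernel_sublevel_subset[OF w \<zeta>]]) (auto intro!: sets_dA_wI)
      also have "\<dots> \<le> ennreal (C1 * (2 * (2 ^ k * \<delta>)) powr (\<alpha> + 2))"
        using \<delta> by (intro C1 \<zeta>) auto
      finally show ?thesis .
    qed
    have pw: "ennreal (cmod (1 - cnj w * z) powr (-t))
        \<le> (\<Sum>k\<le>K. ennreal ((2 ^ k * \<delta> / 2) powr (-t)) * indicator (S k) z)" if z: "z \<in> unit_disk" for z
    proof -
      let ?m = "cmod (1 - cnj w * z)"
      note b = one_minus_cnj_mult_bounds[OF w z, folded \<delta>_def]
      have ex: "?m < 2 ^ K * \<delta>" using b K by (simp add: \<delta>_def)
      \<comment> \<open>Minimality bounds \<open>?m\<close> below by half of its scale; at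
        \<open>k = 0\<close> the general lower bound \<open>\<delta> / 2\<close> does the
        same.\<close>
      define k where "k = (LEAST k. ?m < 2 ^ k * \<delta>)"
      have k1: "?m < 2 ^ k * \<delta>" unfolding k_def by (rule LeastI[where P="\<lambda>k. ?m < 2 ^ k * \<delta>", OF ex])
      have kK: "k \<le> K" unfolding k_def by (rule Least_le[where P="\<lambda>k. ?m < 2 ^ k * \<delta>", OF ex])
      have k2: "2 ^ k * \<delta> / 2 \<le> ?m"
      proof (cases k)
        case (Suc i)
        then have "\<not> ?m < 2 ^ i * \<delta>" using not_less_Least[of i "\<lambda>k. ?m < 2 ^ k * \<delta>"] by (simp add: k_def)
        then show ?thesis using Suc by simp
      qed (use b in auto)
      have "ennreal (?m powr (-t)) \<le> ennreal ((2 ^ k * \<delta> / 2) powr (-t)) * indicator (S k) z"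
        using k1 k2 z \<delta> assms by (auto simp: S_def intro!: ennreal_leI powr_mono2')
      also have "\<dots> \<le> (\<Sum>k\<le>K. ennreal ((2 ^ k * \<delta> / 2) powr (-t)) * indicator (S k) z)"
        using kK by (intro member_le_sum) auto
      finally show ?thesis .
    qed
    have "(\<integral>\<^sup>+ z. ennreal (cmod (1 - cnj w * z) powr (-t)) \<partial>dA_w \<alpha>)
        \<le> (\<integral>\<^sup>+ z. (\<Sum>k\<le>K. ennreal ((2 ^ k * \<delta> / 2) powr (-t)) * indicator (S k) z) \<partial>dA_w \<alpha>)"
      by (intro nn_integral_mono) (use pw in simp)
    also have "\<dots> = (\<Sum>k\<le>K. ennreal ((2 ^ k * \<delta> / 2) powr (-t)) * emeasure (dA_w \<alpha>) (S k))"
      using Sb by (subst nn_integral_sum) (auto simp: nn_integral_cmult_indicator)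
    also have "\<dots> \<le> (\<Sum>k\<le>K. ennreal ((2 ^ k * \<delta> / 2) powr (-t)) * ennreal (C1 * (2 * (2 ^ k * \<delta>)) powr (\<alpha> + 2)))"
      by (intro sum_mono mult_left_mono Sm) auto
    also have "\<dots> = (\<Sum>k\<le>K. ennreal (C * \<delta> powr (\<alpha> + 2 - t) * (2 powr (\<alpha> + 2 - t)) ^ k))"
    proof (intro sum.cong refl)
      fix k
      have "(2 powr (\<alpha> + 2 - t)) ^ k = (2 ^ k :: real) powr (\<alpha> + 2 - t)"
        by (simp add: powr_powr mult.commute flip: powr_realpow)
      moreover have "(2 ^ k * \<delta> / 2) powr (-t) * (2 * (2 ^ k * \<delta>)) powr (\<alpha> + 2)
          = 2 powr (\<alpha> + 2 + t) * ((2 ^ k) powr (\<alpha> + 2 - t) * \<delta> powr (\<alpha> + 2 - t))"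
        using \<delta> by (simp add: powr_mult powr_divide powr_diff powr_add powr_minus field_simps)
      ultimately have "(2 ^ k * \<delta> / 2) powr (-t) * (C1 * (2 * (2 ^ k * \<delta>)) powr (\<alpha> + 2))
          = C * \<delta> powr (\<alpha> + 2 - t) * (2 powr (\<alpha> + 2 - t)) ^ k"
        by (simp add: C_def algebra_simps)
      then show "ennreal ((2 ^ k * \<delta> / 2) powr (-t)) * ennreal (C1 * (2 * (2 ^ k * \<delta>)) powr (\<alpha> + 2))
          = ennreal (C * \<delta> powr (\<alpha> + 2 - t) * (2 powr (\<alpha> + 2 - t)) ^ k)"
        using C1 by (subst ennreal_mult'[symmetric]) auto
    qed
    also have "\<dots> = ennreal (C * \<delta> powr (\<alpha> + 2 - t) * (\<Sum>k\<le>K. (2 powr (\<alpha> + 2 - t)) ^ k))"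
      using C1 by (subst sum_ennreal) (auto simp: sum_distrib_left C_def)
    finally show "(\<integral>\<^sup>+ z. ennreal (cmod (1 - cnj w * z) powr (-t)) \<partial>dA_w \<alpha>)
      \<le> ennreal (C * (1 - (cmod w)\<^sup>2) powr (\<alpha> + 2 - t) * (\<Sum>k\<le>K. (2 powr (\<alpha> + 2 - t)) ^ k))"
      unfolding \<delta>_def .
  qed
qed

text \<open>Above the critical exponent the ratio is below \<open>1\<close>: the smallest scale
  dominates, and the number of scales drops out.\<close>

lemma kernel_integral_power:
  assumes "\<alpha> > -1" "t > \<alpha> + 2"
  obtains C where "C > 0"
    "\<And>w. w \<in> unit_disk \<Longrightarrow>
      (\<integral>\<^sup>+ z. ennreal (cmod (1 - cnj w * z) powr (-t)) \<partial>dA_w \<alpha>)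
      \<le> ennreal (C * (1 - (cmod w)\<^sup>2) powr (\<alpha> + 2 - t))"
proof -
  define x :: real where "x = 2 powr (\<alpha> + 2 - t)"
  have x: "0 < x" "x < 1" using assms powr_less_mono[of "\<alpha>+2-t" 0 2] by (auto simp: x_def)
  obtain C where C: "C > 0"
    "\<And>w K. w \<in> unit_disk \<Longrightarrow> 2 \<le> 2 ^ K * (1 - (cmod w)\<^sup>2) \<Longrightarrow>
      (\<integral>\<^sup>+ z. ennreal (cmod (1 - cnj w * z) powr (-t)) \<partial>dA_w \<alpha>)
      \<le> ennreal (C * (1 - (cmod w)\<^sup>2) powr (\<alpha> + 2 - t) * (\<Sum>k\<le>K. x ^ k))"
    using kernel_integral_dyadic[of \<alpha> t] assms unfolding x_def by auto
  show thesis
  proof (rule that[of "C / (1 - x)"])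
    show "C / (1 - x) > 0" using C x by simp
    fix w :: complex assume w: "w \<in> unit_disk"
    let ?\<delta> = "1 - (cmod w)\<^sup>2"
    have \<delta>: "?\<delta> > 0" using one_minus_cmod_bounds[of w] w by simp
    obtain K where "2 / ?\<delta> < 2 ^ K" using real_arch_pow[of 2 "2 / ?\<delta>"] by auto
    then have "2 \<le> 2 ^ K * ?\<delta>" using \<delta> by (simp add: field_simps)
    note C(2)[OF w this]
    also have "C * ?\<delta> powr (\<alpha> + 2 - t) * (\<Sum>k\<le>K. x ^ k) \<le> C * ?\<delta> powr (\<alpha> + 2 - t) * (1 / (1 - x))"
    proof (intro mult_left_mono)
      have "(\<Sum>k\<le>K. x ^ k) \<le> (\<Sum>k. x ^ k)"
        using x by (intro sum_le_suminf) (auto intro: summable_geometric)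
      also have "\<dots> = 1 / (1 - x)" using x by (simp add: suminf_geometric)
      finally show "(\<Sum>k\<le>K. x ^ k) \<le> 1 / (1 - x)" .
    qed (use C in auto)
    finally show "(\<integral>\<^sup>+ z. ennreal (cmod (1 - cnj w * z) powr (-t)) \<partial>dA_w \<alpha>)
      \<le> ennreal (C / (1 - x) * ?\<delta> powr (\<alpha> + 2 - t))" by (simp add: mult.commute ennreal_leI)
  qed
qed

text \<open>The condition on \<open>n\<close> is what minimality of a dyadic index provides. The one
  step beyond the logarithm is paid for by \<open>ln 2 \<le> ln (2 / \<delta>)\<close>, the purpose
  of the numerator \<open>2\<close>.\<close>

lemma dyadic_count_le_ln:
  fixes \<delta> :: real
  assumes "0 < \<delta>" "\<delta> \<le> 1" "n = 0 \<or> 2 ^ (n - 1) < 2 / \<delta>"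
  shows "real n \<le> 2 / ln 2 * ln (2 / \<delta>)"
proof (cases "n = 0")
  case False
  then have "ln (2 ^ (n - 1)) < ln (2 / \<delta>)" using assms by (subst ln_less_cancel_iff) auto
  then have "(real n - 1) * ln 2 < ln (2 / \<delta>)" using False by (simp add: ln_realpow of_nat_diff)
  moreover have "ln 2 \<le> ln (2 / \<delta>)" using assms by (subst ln_le_cancel_iff) (auto simp: field_simps)
  ultimately have "real n * ln 2 \<le> 2 * ln (2 / \<delta>)" by (simp add: algebra_simps)
  then show ?thesis by (simp add: field_simps)
qed (use assms in auto)

text \<open>At the critical exponent all scales contribute equally, so the bound is the number of
  scales, and \<open>K\<close> has to be chosen minimal.\<close>

lemma kernel_integral_log:
  assumes "\<alpha> > -1"
  obtains C where "C > 0"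
    "\<And>w. w \<in> unit_disk \<Longrightarrow>
      (\<integral>\<^sup>+ z. ennreal (cmod (1 - cnj w * z) powr (-(\<alpha> + 2))) \<partial>dA_w \<alpha>)
      \<le> ennreal (C * ln (2 / (1 - (cmod w)\<^sup>2)))"
proof -
  obtain C where C: "C > 0"
    "\<And>w K. w \<in> unit_disk \<Longrightarrow> 2 \<le> 2 ^ K * (1 - (cmod w)\<^sup>2) \<Longrightarrow>
      (\<integral>\<^sup>+ z. ennreal (cmod (1 - cnj w * z) powr (-(\<alpha> + 2))) \<partial>dA_w \<alpha>)
      \<le> ennreal (C * (1 - (cmod w)\<^sup>2) powr (\<alpha> + 2 - (\<alpha> + 2)) * (\<Sum>k\<le>K. (2 powr (\<alpha> + 2 - (\<alpha> + 2))) ^ k))"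
    using kernel_integral_dyadic[of \<alpha> "\<alpha> + 2"] assms by auto
  show thesis
  proof (rule that[of "C * (4 / ln 2)"])
    show "C * (4 / ln 2) > 0" using C by simp
    fix w :: complex assume w: "w \<in> unit_disk"
    let ?\<delta> = "1 - (cmod w)\<^sup>2"
    have \<delta>: "?\<delta> > 0" using one_minus_cmod_bounds[of w] w by simp
    have ex: "\<exists>K. 2 \<le> 2 ^ K * ?\<delta>"
    proof -
      obtain K where "2 / ?\<delta> < 2 ^ K" using real_arch_pow[of 2 "2 / ?\<delta>"] by auto
      then have "2 \<le> 2 ^ K * ?\<delta>" using \<delta> by (simp add: field_simps)
      then show ?thesis ..
    qed
    define K where "K = (LEAST K. 2 \<le> 2 ^ K * ?\<delta>)"
    have K: "2 \<le> 2 ^ K * ?\<delta>" unfolding K_def by (rule LeastI_ex[OF ex])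
    have "real K \<le> 2 / ln 2 * ln (2 / ?\<delta>)"
    proof (rule dyadic_count_le_ln[OF \<delta>])
      show "K = 0 \<or> 2 ^ (K - 1) < 2 / ?\<delta>"
      proof (cases K)
        case (Suc i)
        then have "\<not> 2 \<le> 2 ^ i * ?\<delta>"
          using not_less_Least[of i "\<lambda>K. 2 \<le> 2 ^ K * ?\<delta>"] unfolding K_def by simp
        then show ?thesis using Suc \<delta> by (simp add: pos_less_divide_eq)
      qed simp
    qed auto
    moreover have "ln 2 \<le> ln (2 / ?\<delta>)"
      using \<delta> by (subst ln_le_cancel_iff) (auto simp: field_simps)
    ultimately have "real K * ln 2 + ln 2 \<le> 2 * ln (2 / ?\<delta>) + ln (2 / ?\<delta>)"
      by (intro add_mono) (auto simp: field_simps)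
    moreover have "0 < ln (2 / ?\<delta>)" using \<open>ln 2 \<le> ln (2 / ?\<delta>)\<close> by (rule less_le_trans[rotated]) simp
    ultimately have "(real K + 1) * ln 2 \<le> 4 * ln (2 / ?\<delta>)" by (simp add: distrib_right)
    then have KK: "real K + 1 \<le> 4 / ln 2 * ln (2 / ?\<delta>)" by (simp add: field_simps)
    note C(2)[OF w K]
    also have "C * ?\<delta> powr (\<alpha> + 2 - (\<alpha> + 2)) * (\<Sum>k\<le>K. (2 powr (\<alpha> + 2 - (\<alpha> + 2))) ^ k) = C * (real K + 1)"
      using \<delta> by simp
    also have "\<dots> \<le> C * (4 / ln 2 * ln (2 / ?\<delta>))" using C KK by (intro mult_left_mono) auto
    finally show "(\<integral>\<^sup>+ z. ennreal (cmod (1 - cnj w * z) powr (-(\<alpha> + 2))) \<partial>dA_w \<alpha>)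
      \<le> ennreal (C * (4 / ln 2) * ln (2 / ?\<delta>))" by (simp add: mult.assoc ennreal_leI)
  qed
qed

section \<open>Growth of functions in the Dirichlet space\<close>

lemma half_ball_cmod:
  assumes "w \<in> unit_disk" "z \<in> ball w ((1 - cmod w) / 2)"
  shows "(1 - cmod w) / 2 < 1 - cmod z" "1 - cmod z < 3 / 2 * (1 - cmod w)"
proof -
  have "\<bar>cmod w - cmod z\<bar> < (1 - cmod w) / 2"
    using assms norm_triangle_ineq3[of w z] by (simp add: dist_norm)
  then show "(1 - cmod w) / 2 < 1 - cmod z" "1 - cmod z < 3 / 2 * (1 - cmod w)"
    by (auto simp: abs_if field_simps split: if_splits)
qed

lemma half_ball_subset:
  assumes "w \<in> unit_disk"
  shows "ball w ((1 - cmod w) / 2) \<subseteq> unit_disk"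
  using half_ball_cmod[OF assms] assms by force

text \<open>On the half ball \<open>1 - cmod v\<close> changes by a factor of at most
  \<open>2\<close>, and passing to squared moduli costs another \<open>2\<close>; this is the base
  \<open>4\<close>. The area of the ball cancels the \<open>pi\<close> of the measure.\<close>

lemma emeasure_dA_w_ball_ge:
  assumes w: "w \<in> unit_disk" and sub: "ball z r \<subseteq> ball w ((1 - cmod w) / 2)" and "r \<ge> 0"
  shows "ennreal (4 powr (-\<bar>\<alpha>\<bar>) * (1 - (cmod w)\<^sup>2) powr \<alpha> * r\<^sup>2) \<le> emeasure (dA_w \<alpha>) (ball z r)"
proof -
  have "ennreal (4 powr (-\<bar>\<alpha>\<bar>) * (1 - (cmod w)\<^sup>2) powr \<alpha> / pi) * emeasure lborel (ball z r)
      \<le> emeasure (dA_w \<alpha>) (ball z r)"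
  proof (rule emeasure_dA_w_ge)
    show "ball z r \<subseteq> unit_disk" using sub half_ball_subset[OF w] by blast
    fix v assume "v \<in> ball z r"
    then have v: "v \<in> ball w ((1 - cmod w) / 2)" using sub by blast
    note b = half_ball_cmod[OF w v] one_minus_cmod_bounds[of w] one_minus_cmod_bounds[of v]
    have "cmod w < 1" using w by simp
    with b have "(1 - (cmod w)\<^sup>2) powr \<alpha> \<le> 4 powr \<bar>\<alpha>\<bar> * (1 - (cmod v)\<^sup>2) powr \<alpha>"
      by (intro powr_comparable) auto
    then show "4 powr - \<bar>\<alpha>\<bar> * (1 - (cmod w)\<^sup>2) powr \<alpha> \<le> (1 - (cmod v)\<^sup>2) powr \<alpha>"
      by (simp add: powr_minus field_simps)
  qed auto
  also have "ennreal (4 powr (-\<bar>\<alpha>\<bar>) * (1 - (cmod w)\<^sup>2) powr \<alpha> / pi) * emeasure lborel (ball z r)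
      = ennreal (4 powr (-\<bar>\<alpha>\<bar>) * (1 - (cmod w)\<^sup>2) powr \<alpha> * r\<^sup>2)"
    using assms by (subst emeasure_complex_ball) (auto simp flip: ennreal_mult')
  finally show ?thesis .
qed

text \<open>Cauchy's inequality on disks of radius \<open>d / 2\<close> bounds the derivative by
  \<open>2 * A * cmod (h z0) / d\<close> throughout \<open>ball z0 (d / 4)\<close>. Within distance
  \<open>d / (4 * A)\<close> of \<open>z0\<close>, which \<open>A \<ge> 1\<close> keeps inside that
  ball, the value then changes by at most \<open>cmod (h z0) / 2\<close>.\<close>

lemma holomorphic_half_below:
  assumes hol: "h holomorphic_on cball z0 d" and "d > 0"
    and bound: "\<And>z. z \<in> cball z0 d \<Longrightarrow> cmod (h z) \<le> A * cmod (h z0)" and "A \<ge> 1"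
    and z: "z \<in> ball z0 (d / (4 * A))"
  shows "cmod (h z0) / 2 \<le> cmod (h z)"
proof -
  define B where "B = A * cmod (h z0)"
  have B: "B \<ge> 0" using assms by (simp add: B_def)
  have s: "d / (4 * A) \<le> d / 4" using assms by (simp add: field_simps)
  have holb: "h holomorphic_on ball z0 d" using hol by (rule holomorphic_on_subset) auto
  have der: "cmod (deriv h x) \<le> 2 * B / d" if x: "x \<in> ball z0 (d / 4)" for x
  proof -
    have "cball x (d / 2) \<subseteq> cball z0 d"
      using x assms(2) by (intro cball_subset_cball_iff[THEN iffD2]) (auto simp: dist_commute)
    then have "cmod ((deriv ^^ 1) h x) \<le> fact 1 * B / (d / 2) ^ 1"
      using assms(2) bound
      by (intro Cauchy_inequality holomorphic_on_subset[OF hol] holomorphic_on_imp_continuous_on)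
         (auto simp: B_def subset_eq dist_norm)
    then show ?thesis by (simp add: field_simps)
  qed
  have "cmod (h z - h z0) \<le> 2 * B / d * cmod (z - z0)"
  proof (rule field_differentiable_bound[of "ball z0 (d/4)" h "deriv h"])
    fix x assume "x \<in> ball z0 (d / 4)"
    then have "x \<in> ball z0 d" using assms(2) by auto
    then show "(h has_field_derivative deriv h x) (at x within ball z0 (d / 4))"
      using holomorphic_derivI[OF holb] by blast
  qed (use z s assms(2) der in auto)
  also have "\<dots> \<le> 2 * B / d * (d / (4 * A))"
    using z B assms(2) by (intro mult_left_mono) (auto simp: dist_norm norm_minus_commute)
  also have "\<dots> = cmod (h z0) / 2" using assms by (simp add: B_def)
  finally show ?thesis using norm_triangle_ineq3[of "h z" "h z0"] by linarith
qed

text \<open>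
  For \<open>p < 1\<close> the mean value property does not bound \<open>\<bar>h w\<bar> powr p\<close> directly. Instead, pass to
  the maximum point \<open>z0\<close> of \<open>\<bar>h z\<bar> powr p * (r - dist w z)\<^sup>2\<close>: near \<open>z0\<close> the function \<open>h\<close> is
  bounded by a multiple of \<open>\<bar>h z0\<bar>\<close>, so Cauchy's inequality also bounds it from below there.
\<close>

lemma local_estimate:
  fixes p \<alpha> :: real
  assumes "p > 0"
  obtains C where "C > 0"
    "\<And>h w. h holomorphic_on unit_disk \<Longrightarrow> w \<in> unit_disk \<Longrightarrow>
      ennreal (cmod (h w) powr p * (1 - (cmod w)\<^sup>2) powr (\<alpha> + 2))
      \<le> ennreal C * (\<integral>\<^sup>+ z. ennreal (cmod (h z) powr p) * indicator (ball w ((1 - cmod w) / 2)) z \<partial>dA_w \<alpha>)"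
proof -
  define A :: real where "A = 4 powr (1 / p)"
  have A: "A \<ge> 1" using assms by (simp add: A_def ge_one_powr_ge_zero)
  \<comment> \<open>The factors come from the lower bound by half of \<open>cmod (h z0)\<close>,
    from the oscillation of the weight on the half ball, and from the radius
    \<open>d / (4 * A)\<close>.\<close>
  define c where "c = (1/2) powr p * 4 powr (-\<bar>\<alpha>\<bar>) / (4 * A)\<^sup>2"
  have c: "c > 0" using A by (simp add: c_def)
  show thesis
  \<comment> \<open>A factor \<open>4\<close> comes from \<open>d\<close> being half of the margin
    \<open>r - dist w z0\<close>, a factor \<open>16\<close> from squaring
    \<open>\<delta> \<le> 4 * r\<close>.\<close>
  proof (rule that[of "64 / c"])
    show "64 / c > 0" using c by simp
    fix h w assume hol: "h holomorphic_on unit_disk" and w: "w \<in> unit_disk"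
    define r where "r = (1 - cmod w) / 2"
    have r: "r > 0" using w by (simp add: r_def)
    have rs: "ball w r \<subseteq> unit_disk" using half_ball_subset[OF w] by (simp add: r_def)
    have crs: "cball w r \<subseteq> unit_disk"
    proof
      fix z assume "z \<in> cball w r"
      then show "z \<in> unit_disk" using norm_triangle_ineq2[of z w] w by (auto simp: r_def dist_norm norm_minus_commute)
    qed
    define m where "m z = cmod (h z) powr p * (r - dist w z)\<^sup>2" for z
    have "continuous_on (cball w r) h"
      by (rule holomorphic_on_imp_continuous_on[OF holomorphic_on_subset[OF hol crs]])
    then have "continuous_on (cball w r) m"
      unfolding m_def using assms by (intro continuous_intros continuous_on_powr') auto
    then obtain z0 where z0: "z0 \<in> cball w r" "\<And>z. z \<in> cball w r \<Longrightarrow> m z \<le> m z0"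
      using continuous_attains_sup[of "cball w r" m] r by auto
    let ?I = "\<integral>\<^sup>+ z. ennreal (cmod (h z) powr p) * indicator (ball w r) z \<partial>dA_w \<alpha>"
    let ?\<delta> = "1 - (cmod w)\<^sup>2"
    have mw: "cmod (h w) powr p * r\<^sup>2 \<le> m z0" using z0(2)[of w] r by (simp add: m_def)
    have main: "ennreal (c * ?\<delta> powr \<alpha> * m z0) \<le> ennreal 4 * ?I"
    \<comment> \<open>In the degenerate case the maximum \<open>m z0\<close> is \<open>0\<close> and
      nothing is claimed.\<close>
    proof (cases "h z0 = 0 \<or> dist w z0 = r")
      case True
      then show ?thesis using assms by (auto simp: m_def)
    next
      case False
      define d where "d = (r - dist w z0) / 2"
      have d: "d > 0" using False z0(1) by (auto simp: d_def)
      have sub: "cball z0 d \<subseteq> ball w r"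
      proof
        fix z assume "z \<in> cball z0 d"
        then show "z \<in> ball w r" using dist_triangle[of w z z0] d by (auto simp: d_def)
      qed
      define s where "s = d / (4 * A)"
      have s: "s > 0" "s \<le> d" using d A by (auto simp: s_def field_simps)
      have low: "cmod (h z0) / 2 \<le> cmod (h z)" if "z \<in> ball z0 s" for z
      proof (rule holomorphic_half_below[of h z0 d A])
        show "h holomorphic_on cball z0 d" using hol sub rs by (intro holomorphic_on_subset[OF hol]) blast
        fix z assume z: "z \<in> cball z0 d"
        \<comment> \<open>A move by \<open>d\<close> uses up at most half of the margin
          \<open>2 * d\<close> at \<open>z0\<close>. Maximality of \<open>m z0\<close> then loses
          only the factor \<open>4\<close>, whose \<open>p\<close>-th root is
          \<open>A\<close>.\<close>
        have dz: "d \<le> r - dist w z" using dist_triangle[of w z z0] z by (auto simp: d_def)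
        have "cmod (h z) powr p * d\<^sup>2 \<le> m z"
          unfolding m_def using dz d by (intro mult_left_mono power_mono) auto
        also have "m z \<le> m z0" using z sub by (intro z0(2)) auto
        also have "m z0 = (4 * cmod (h z0) powr p) * d\<^sup>2" by (simp add: m_def d_def power2_eq_square)
        finally have "cmod (h z) powr p \<le> 4 * cmod (h z0) powr p" using d by simp
        then have "(cmod (h z) powr p) powr (1/p) \<le> (4 * cmod (h z0) powr p) powr (1/p)"
          using assms by (intro powr_mono2) auto
        then show "cmod (h z) \<le> A * cmod (h z0)"
          using assms by (simp add: powr_mult powr_powr A_def)
      qed (use d A that in \<open>auto simp: s_def\<close>)
      have ss: "ball z0 s \<subseteq> ball w r" using sub s by auto
      have "ennreal ((cmod (h z0) / 2) powr p) * emeasure (dA_w \<alpha>) (ball z0 s)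
          = (\<integral>\<^sup>+ z. ennreal ((cmod (h z0) / 2) powr p) * indicator (ball z0 s) z \<partial>dA_w \<alpha>)"
        using ss rs by (subst nn_integral_cmult_indicator) (auto intro!: sets_dA_wI)
      also have "\<dots> \<le> ?I"
        using low ss assms by (intro nn_integral_mono) (auto simp: indicator_def intro!: ennreal_leI powr_mono2)
      finally have "ennreal ((cmod (h z0) / 2) powr p) * emeasure (dA_w \<alpha>) (ball z0 s) \<le> ?I" .
      moreover have "ennreal (4 powr (-\<bar>\<alpha>\<bar>) * ?\<delta> powr \<alpha> * s\<^sup>2) \<le> emeasure (dA_w \<alpha>) (ball z0 s)"
        using ss s by (intro emeasure_dA_w_ball_ge[OF w]) (auto simp: r_def)
      ultimately have "ennreal ((cmod (h z0) / 2) powr p) * ennreal (4 powr (-\<bar>\<alpha>\<bar>) * ?\<delta> powr \<alpha> * s\<^sup>2) \<le> ?I"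
        by (meson mult_left_mono order_trans zero_le)
      moreover have "(cmod (h z0) / 2) powr p * (4 powr (-\<bar>\<alpha>\<bar>) * ?\<delta> powr \<alpha> * s\<^sup>2) = c * ?\<delta> powr \<alpha> * m z0 / 4"
        by (simp add: c_def m_def s_def d_def powr_divide power2_eq_square mult_ac)
      ultimately have "ennreal (c * ?\<delta> powr \<alpha> * m z0 / 4) \<le> ?I"
        by (subst (asm) ennreal_mult'[symmetric]) simp_all
      then have "ennreal 4 * ennreal (c * ?\<delta> powr \<alpha> * m z0 / 4) \<le> ennreal 4 * ?I"
        by (intro mult_left_mono) auto
      then show ?thesis by (subst (asm) ennreal_mult'[symmetric]) auto
    qed
    have \<delta>: "0 < ?\<delta>" "?\<delta> \<le> 4 * r" using one_minus_cmod_bounds[of w] w by (auto simp: r_def)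
    have "c * ?\<delta> powr \<alpha> * (cmod (h w) powr p * (?\<delta> / 4)\<^sup>2) \<le> c * ?\<delta> powr \<alpha> * (cmod (h w) powr p * r\<^sup>2)"
      using c \<delta> by (intro mult_left_mono power_mono) auto
    also have "\<dots> \<le> c * ?\<delta> powr \<alpha> * m z0" using c mw by (intro mult_left_mono) auto
    finally have "ennreal (c * ?\<delta> powr \<alpha> * (cmod (h w) powr p * (?\<delta> / 4)\<^sup>2)) \<le> ennreal 4 * ?I"
      using main by (meson ennreal_leI order_trans)
    then have le: "ennreal (16 / c) * ennreal (c * ?\<delta> powr \<alpha> * (cmod (h w) powr p * (?\<delta> / 4)\<^sup>2)) \<le> ennreal (16 / c) * (ennreal 4 * ?I)"
      by (intro mult_left_mono) auto
    have "(16 / c) * (c * ?\<delta> powr \<alpha> * (cmod (h w) powr p * (?\<delta> / 4)\<^sup>2)) = cmod (h w) powr p * ?\<delta> powr (\<alpha> + 2)"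
      using c \<delta> powr_realpow[of ?\<delta> 2] by (simp add: powr_add power2_eq_square)
    then have "ennreal (cmod (h w) powr p * ?\<delta> powr (\<alpha> + 2))
        = ennreal (16 / c) * ennreal (c * ?\<delta> powr \<alpha> * (cmod (h w) powr p * (?\<delta> / 4)\<^sup>2))"
      using c by (metis ennreal_mult' divide_nonneg_pos zero_le_numeral)
    also note le
    also have "ennreal (16 / c) * (ennreal 4 * ?I) = ennreal (64 / c) * ?I"
      using c by (simp add: mult.assoc[symmetric] del: ennreal_numeral flip: ennreal_mult')
    finally show "ennreal (cmod (h w) powr p * ?\<delta> powr (\<alpha> + 2))
      \<le> ennreal (64 / c) * (\<integral>\<^sup>+ z. ennreal (cmod (h z) powr p) * indicator (ball w ((1 - cmod w) / 2)) z \<partial>dA_w \<alpha>)"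
      by (simp add: r_def)
  qed
qed

lemma dirichlet_norm_le_1D:
  assumes "p > 0" "f \<in> dirichlet_space p \<alpha>" "dirichlet_norm p \<alpha> f \<le> 1"
  shows "cmod (f 0) \<le> 1" "(\<integral>\<^sup>+ z. ennreal (cmod (deriv f z) powr p) \<partial>dA_w \<alpha>) \<le> 1"
proof -
  let ?I = "\<integral>\<^sup>+ z. ennreal (cmod (deriv f z) powr p) \<partial>dA_w \<alpha>"
  define x where "x = cmod (f 0) powr p + enn2real ?I"
  \<comment> \<open>Since \<open>enn2real\<close> sends infinity to \<open>0\<close>, a bound on
    \<open>dirichlet_norm\<close> alone says nothing about the integral; membership in the space
    supplies finiteness.\<close>
  have fin: "?I < \<infinity>" using assms by (simp add: dirichlet_space_def finite_int_def)
  have x: "x \<ge> 0" "x powr (1/p) \<le> 1" using assms by (auto simp: x_def dirichlet_norm_def)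
  have "x \<le> 1"
  proof (rule ccontr)
    assume "\<not> x \<le> 1"
    then have "x powr (1/p) > 1" using assms by (intro gr_one_powr) auto
    with x show False by simp
  qed
  then have 1: "cmod (f 0) powr p \<le> 1" "enn2real ?I \<le> 1"
    by (auto simp: x_def intro: order_trans[rotated])
  then show "cmod (f 0) \<le> 1" using assms by (metis gr_one_powr not_le)
  have "?I = ennreal (enn2real ?I)" using fin by simp
  also have "\<dots> \<le> ennreal 1" using 1(2) by (rule ennreal_leI)
  finally show "?I \<le> 1" by simp
qed

lemma dirichlet_holomorphic:
  assumes "f \<in> dirichlet_space p \<alpha>"
  shows "f holomorphic_on unit_disk" "deriv f holomorphic_on unit_disk"
  using assms by (auto simp: dirichlet_space_def intro: holomorphic_deriv)

text \<open>The local estimate is applied to \<open>deriv f\<close>; the energy near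
  \<open>w\<close> is at most the total energy, which is at most \<open>1\<close> on the unit
  ball.\<close>

lemma deriv_growth:
  fixes p \<alpha> :: real
  assumes "p > 0"
  obtains C where "C > 0"
    "\<And>f w. f \<in> dirichlet_space p \<alpha> \<Longrightarrow> dirichlet_norm p \<alpha> f \<le> 1 \<Longrightarrow> w \<in> unit_disk \<Longrightarrow>
      cmod (deriv f w) \<le> C * (1 - (cmod w)\<^sup>2) powr (-(\<alpha> + 2) / p)"
proof -
  obtain C where C: "C > 0" "\<And>h w. h holomorphic_on unit_disk \<Longrightarrow> w \<in> unit_disk \<Longrightarrow>
      ennreal (cmod (h w) powr p * (1 - (cmod w)\<^sup>2) powr (\<alpha> + 2))
      \<le> ennreal C * (\<integral>\<^sup>+ z. ennreal (cmod (h z) powr p) * indicator (ball w ((1 - cmod w) / 2)) z \<partial>dA_w \<alpha>)"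
    using local_estimate[OF assms] by blast
  show thesis
  proof (rule that[of "C powr (1/p)"])
    show "C powr (1/p) > 0" using C by simp
    fix f w assume f: "f \<in> dirichlet_space p \<alpha>" "dirichlet_norm p \<alpha> f \<le> 1" and w: "w \<in> unit_disk"
    let ?\<delta> = "1 - (cmod w)\<^sup>2"
    have \<delta>: "0 < ?\<delta>" using one_minus_cmod_bounds[of w] w by auto
    have "ennreal (cmod (deriv f w) powr p * ?\<delta> powr (\<alpha> + 2))
      \<le> ennreal C * (\<integral>\<^sup>+ z. ennreal (cmod (deriv f z) powr p) * indicator (ball w ((1 - cmod w) / 2)) z \<partial>dA_w \<alpha>)"
      by (rule C(2)[OF dirichlet_holomorphic(2)[OF f(1)] w])
    also have "\<dots> \<le> ennreal C * (\<integral>\<^sup>+ z. ennreal (cmod (deriv f z) powr p) \<partial>dA_w \<alpha>)"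
      by (intro mult_left_mono nn_integral_mono) (auto simp: indicator_def)
    also have "\<dots> \<le> ennreal C * 1"
      by (intro mult_left_mono dirichlet_norm_le_1D(2)[OF assms f]) auto
    finally have "cmod (deriv f w) powr p * ?\<delta> powr (\<alpha> + 2) \<le> C" using C by simp
    then have "cmod (deriv f w) powr p \<le> C * ?\<delta> powr (-(\<alpha> + 2))"
      using \<delta> by (simp add: powr_minus field_simps del: minus_add_distrib)
    then have "(cmod (deriv f w) powr p) powr (1/p) \<le> (C * ?\<delta> powr (-(\<alpha> + 2))) powr (1/p)"
      using assms by (intro powr_mono2) auto
    then show "cmod (deriv f w) \<le> C powr (1/p) * ?\<delta> powr (-(\<alpha> + 2) / p)"
      using assms C by (simp add: powr_mult powr_powr)
  qed
qed

section \<open>Integration of the derivative bound along radii\<close>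

text \<open>A mean value inequality whose bound may vary along the segment, with a primitive
  \<open>\<Phi>\<close> in place of an integral. It is used with \<open>w\<close> itself over
  \<open>[0, 1]\<close> and with a unit vector over dyadic intervals.\<close>

lemma radial_segment:
  assumes "f holomorphic_on unit_disk" "0 \<le> a" "a \<le> b" "of_real b * w \<in> unit_disk"
  assumes phi: "\<And>t. a \<le> t \<Longrightarrow> t \<le> b \<Longrightarrow> (\<Phi> has_real_derivative \<Phi>' t) (at t)"
    and bound: "\<And>t. a < t \<Longrightarrow> t < b \<Longrightarrow> cmod w * cmod (deriv f (of_real t * w)) \<le> \<Phi>' t"
  shows "cmod (f (of_real b * w) - f (of_real a * w)) \<le> \<Phi> b - \<Phi> a"
proof (cases "a = b")
  case False
  have in_disk: "of_real t * w \<in> unit_disk" if "a \<le> t" "t \<le> b" for t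
    using assms that mult_right_mono[of t b "cmod w"] by (auto simp: norm_mult)
  have der: "((\<lambda>t. f (of_real t * w)) has_vector_derivative w * deriv f (of_real t * w)) (at t)"
    if "a \<le> t" "t \<le> b" for t
  proof -
    have "((\<lambda>t::real. of_real t * w) has_vector_derivative w) (at t)"
      by (auto intro!: derivative_eq_intros simp: has_vector_derivative_def scaleR_conv_of_real)
    moreover have "(f has_field_derivative deriv f (of_real t * w)) (at (of_real t * w))"
      using assms(1) in_disk[OF that] by (intro holomorphic_derivI) auto
    ultimately show ?thesis
      using field_vector_diff_chain_at[of "\<lambda>t::real. of_real t * w" w t f] by (simp add: o_def)
  qed
  show ?thesis
  proof (rule differentiable_bound_general[where f = "\<lambda>t. f (of_real t * w)"
        and f' = "\<lambda>t. w * deriv f (of_real t * w)" and \<phi> = \<Phi> and \<phi>' = \<Phi>'])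
    show "a < b" using False assms by simp
    show "continuous_on {a..b} (\<lambda>t. f (of_real t * w))"
      using der by (intro continuous_at_imp_continuous_on ballI has_vector_derivative_continuous) auto
    show "continuous_on {a..b} \<Phi>"
      using phi by (intro continuous_at_imp_continuous_on ballI DERIV_isCont) auto
    fix t assume t: "a < t" "t < b"
    show "((\<lambda>t. f (of_real t * w)) has_vector_derivative w * deriv f (of_real t * w)) (at t)"
      using der t by simp
    show "(\<Phi> has_vector_derivative \<Phi>' t) (at t)"
      using phi t by (simp add: has_real_derivative_iff_has_vector_derivative)
    show "norm (w * deriv f (of_real t * w)) \<le> \<Phi>' t" using bound[OF t] by (simp add: norm_mult)
  qed
qed simp

text \<open>One formula covers both sides of \<open>s = 1\<close>: the fraction blows up at the
  circle when \<open>1 - s\<close> is negative and stays below \<open>C / (1 - s)\<close> when it is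
  positive. The summand \<open>1\<close> bounds \<open>f 0\<close>.\<close>

lemma growth_integrated:
  fixes p \<alpha> :: real
  assumes "p > 0" "\<alpha> > -1" "p \<noteq> \<alpha> + 2"
  obtains C where "C > 0"
    "\<And>f w. f \<in> dirichlet_space p \<alpha> \<Longrightarrow> dirichlet_norm p \<alpha> f \<le> 1 \<Longrightarrow> w \<in> unit_disk \<Longrightarrow>
      cmod (f w) \<le> 1 + C * (1 - (1 - cmod w) powr (1 - (\<alpha> + 2) / p)) / (1 - (\<alpha> + 2) / p)"
proof -
  obtain C where C: "C > 0"
    "\<And>f w. f \<in> dirichlet_space p \<alpha> \<Longrightarrow> dirichlet_norm p \<alpha> f \<le> 1 \<Longrightarrow> w \<in> unit_disk \<Longrightarrow>
      cmod (deriv f w) \<le> C * (1 - (cmod w)\<^sup>2) powr (-(\<alpha> + 2) / p)"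
    using deriv_growth[OF assms(1)] by blast
  define s where "s = (\<alpha> + 2) / p"
  have s: "s > 0" "s \<noteq> 1" using assms by (auto simp: s_def)
  show thesis
  proof (rule that[OF C(1)])
    fix f w assume f: "f \<in> dirichlet_space p \<alpha>" "dirichlet_norm p \<alpha> f \<le> 1" and w: "w \<in> unit_disk"
    let ?\<Phi> = "\<lambda>t. - C / (1 - s) * (1 - t * cmod w) powr (1 - s)"
    have pos: "1 - t * cmod w > 0" if "0 \<le> t" "t \<le> 1" for t
      using w that mult_mono[of "t" 1 "cmod w" "cmod w"] by auto
    have "cmod (f (of_real 1 * w) - f (of_real 0 * w)) \<le> ?\<Phi> 1 - ?\<Phi> 0"
    proof (rule radial_segment[OF dirichlet_holomorphic(1)[OF f(1)]])
      fix t :: real assume t: "0 \<le> t" "t \<le> 1"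
      have "((\<lambda>t. (1 - t * cmod w) powr (1 - s)) has_real_derivative
          (1 - s) * (1 - t * cmod w) powr (1 - s - of_nat 1) * (- cmod w)) (at t)"
        by (rule DERIV_fun_powr) (use pos[OF t] in \<open>auto intro!: derivative_eq_intros\<close>)
      from DERIV_cmult[OF this, of "- C / (1 - s)"]
      show "(?\<Phi> has_real_derivative C * cmod w * (1 - t * cmod w) powr (- s)) (at t)"
        by (rule DERIV_cong) (use s in simp)
    next
      fix t :: real assume t: "0 < t" "t < 1"
      then have p: "1 - t * cmod w > 0" using pos by simp
      have c: "cmod (of_real t * w) = t * cmod w" using t by (simp add: norm_mult)
      have exponent: "-(\<alpha> + 2) / p = - s" by (simp only: s_def minus_divide_left)
      have tw: "of_real t * w \<in> unit_disk" using p c by simp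
      have "cmod (deriv f (of_real t * w)) \<le> C * (1 - (t * cmod w)\<^sup>2) powr (- s)"
        using C(2)[OF f tw] unfolding exponent c .
      also have "\<dots> \<le> C * (1 - t * cmod w) powr (- s)"
      proof (intro mult_left_mono powr_mono2')
        show "1 - t * cmod w \<le> 1 - (t * cmod w)\<^sup>2"
          using one_minus_cmod_bounds(1)[of "of_real t * w"] p c by simp
      qed (use C(1) s p in auto)
      finally have "cmod w * cmod (deriv f (of_real t * w)) \<le> cmod w * (C * (1 - t * cmod w) powr (- s))"
        by (intro mult_left_mono) auto
      then show "cmod w * cmod (deriv f (of_real t * w)) \<le> C * cmod w * (1 - t * cmod w) powr (- s)"
        by (simp only: mult_ac)
    qed (use w in auto)
    also have "\<dots> = C * (1 - (1 - cmod w) powr (1 - s)) / (1 - s)"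
      by (simp add: diff_divide_distrib right_diff_distrib)
    finally show "cmod (f w) \<le> 1 + C * (1 - (1 - cmod w) powr (1 - (\<alpha> + 2) / p)) / (1 - (\<alpha> + 2) / p)"
      using norm_triangle_ineq2[of "f w" "f 0"] dirichlet_norm_le_1D(1)[OF assms(1) f] by (simp add: s_def)
  qed
qed

lemma growth_power:
  fixes p \<alpha> :: real
  assumes "p > 0" "\<alpha> > -1" "p < \<alpha> + 2"
  obtains C where "C > 0"
    "\<And>f w. f \<in> dirichlet_space p \<alpha> \<Longrightarrow> dirichlet_norm p \<alpha> f \<le> 1 \<Longrightarrow> w \<in> unit_disk \<Longrightarrow>
      cmod (f w) \<le> C * (1 - (cmod w)\<^sup>2) powr (1 - (\<alpha> + 2) / p)"
proof -
  obtain C where C: "C > 0"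
    "\<And>f w. f \<in> dirichlet_space p \<alpha> \<Longrightarrow> dirichlet_norm p \<alpha> f \<le> 1 \<Longrightarrow> w \<in> unit_disk \<Longrightarrow>
      cmod (f w) \<le> 1 + C * (1 - (1 - cmod w) powr (1 - (\<alpha> + 2) / p)) / (1 - (\<alpha> + 2) / p)"
    using growth_integrated[of p \<alpha>] assms by auto
  define e where "e = (\<alpha> + 2) / p - 1"
  have e: "e > 0" using assms by (simp add: e_def field_simps)
  have ee: "1 - (\<alpha> + 2) / p = - e" by (simp add: e_def)
  show thesis
  proof (rule that[of "1 + C * 2 powr e / e"])
    show "1 + C * 2 powr e / e > 0" using C e by (simp add: add_pos_nonneg)
    fix f w assume f: "f \<in> dirichlet_space p \<alpha>" "dirichlet_norm p \<alpha> f \<le> 1" and w: "w \<in> unit_disk"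
    let ?\<delta> = "1 - (cmod w)\<^sup>2"
    have \<delta>: "0 < ?\<delta>" "?\<delta> \<le> 1" "?\<delta> / 2 \<le> 1 - cmod w" using one_minus_cmod_bounds[of w] w by auto
    have "(1 - cmod w) powr (-e) \<le> (?\<delta> / 2) powr (-e)" using \<delta> e by (intro powr_mono2') auto
    also have "\<dots> = 2 powr e * ?\<delta> powr (-e)" using \<delta> by (simp add: powr_divide powr_minus field_simps)
    finally have 1: "(1 - cmod w) powr (-e) \<le> 2 powr e * ?\<delta> powr (-e)" .
    have "cmod (f w) \<le> 1 + C * (1 - (1 - cmod w) powr (- e)) / (- e)"
      using C(2)[OF f w] unfolding ee .
    also have "\<dots> = 1 + C / e * ((1 - cmod w) powr (- e) - 1)" using e by (simp add: field_simps)
    also have "\<dots> \<le> ?\<delta> powr (-e) + C / e * (2 powr e * ?\<delta> powr (-e))"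
      using 1 C e \<delta> powr_mono2'[of "-e" ?\<delta> 1] by (intro add_mono mult_left_mono) auto
    also have "\<dots> = (1 + C * 2 powr e / e) * ?\<delta> powr (-e)" by (simp add: field_simps)
    finally show "cmod (f w) \<le> (1 + C * 2 powr e / e) * ?\<delta> powr (1 - (\<alpha> + 2) / p)" unfolding ee .
  qed
qed

lemma growth_bounded:
  fixes p \<alpha> :: real
  assumes "\<alpha> > -1" "p > \<alpha> + 2"
  obtains C where "C > 0"
    "\<And>f w. f \<in> dirichlet_space p \<alpha> \<Longrightarrow> dirichlet_norm p \<alpha> f \<le> 1 \<Longrightarrow> w \<in> unit_disk \<Longrightarrow>
      cmod (f w) \<le> C"
proof -
  obtain C where C: "C > 0"
    "\<And>f w. f \<in> dirichlet_space p \<alpha> \<Longrightarrow> dirichlet_norm p \<alpha> f \<le> 1 \<Longrightarrow> w \<in> unit_disk \<Longrightarrow>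
      cmod (f w) \<le> 1 + C * (1 - (1 - cmod w) powr (1 - (\<alpha> + 2) / p)) / (1 - (\<alpha> + 2) / p)"
    using growth_integrated[of p \<alpha>] assms by auto
  define e where "e = 1 - (\<alpha> + 2) / p"
  have e: "e > 0" using assms by (simp add: e_def field_simps)
  show thesis
  proof (rule that[of "1 + C / e"])
    show "1 + C / e > 0" using C e by (simp add: add_pos_nonneg)
    fix f w assume f: "f \<in> dirichlet_space p \<alpha>" "dirichlet_norm p \<alpha> f \<le> 1" and w: "w \<in> unit_disk"
    have "C * (1 - (1 - cmod w) powr e) / e \<le> C / e"
      using C e by (intro divide_right_mono) (auto simp: algebra_simps)
    then show "cmod (f w) \<le> 1 + C / e" using C(2)[OF f w, folded e_def] by linarith
  qed
qed

section \<open>Logarithmic growth at the critical exponent\<close>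

text \<open>If \<open>m\<close> is the smallest admissible index and \<open>k \<ge> m + 4\<close>,
  then the upper end \<open>2 / 2 ^ k\<close> of window \<open>k\<close> lies below the lower end
  \<open>1 / 2 ^ (m + 2)\<close> of window \<open>m\<close>. So at most four windows contain
  \<open>x\<close>.\<close>

lemma sum_indicator_dyadic_annuli_le:
  fixes x :: real
  assumes "0 < x"
  shows "(\<Sum>k<K. indicator {x. 1 / 2 ^ (k + 2) \<le> x \<and> x \<le> 2 / 2 ^ k} x) \<le> (4::ennreal)"
proof -
  define S where "S = {k. k < K \<and> 1 / 2 ^ (k + 2) \<le> x \<and> x \<le> 2 / 2 ^ k}"
  have "card S \<le> 4"
  proof (cases "S = {}")
    case False
    define m where "m = (LEAST k. k \<in> S)"
    have m: "m \<in> S" "\<And>k. k \<in> S \<Longrightarrow> m \<le> k"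
      using False unfolding m_def by (auto intro: LeastI Least_le)
    have "S \<subseteq> {m..<m + 4}"
    proof
      fix k assume k: "k \<in> S"
      have "\<not> m + 4 \<le> k"
      proof
        assume "m + 4 \<le> k"
        then have "(2::real) ^ (m + 4) \<le> 2 ^ k" by (intro power_increasing) auto
        then have "2 / 2 ^ k \<le> 2 / (2::real) ^ (m + 4)" by (intro divide_left_mono) auto
        also have "\<dots> < 1 / 2 ^ (m + 2)" by (simp add: power_add field_simps)
        finally show False using m(1) k by (auto simp: S_def)
      qed
      then show "k \<in> {m..<m + 4}" using m(2)[OF k] by auto
    qed
    then have "card S \<le> card {m..<m + 4}" by (intro card_mono) auto
    then show ?thesis by simp
  qed simp
  have "(\<Sum>k<K. indicator {x. 1 / 2 ^ (k + 2) \<le> x \<and> x \<le> 2 / 2 ^ k} x) = (\<Sum>k<K. indicator S k :: ennreal)"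
    by (intro sum.cong) (auto simp: S_def indicator_def)
  also have "\<dots> = of_nat (card S)"
  proof -
    have "(\<Sum>k<K. indicator S k :: ennreal) = (\<Sum>k\<in>S. 1)"
      by (rule sum.mono_neutral_cong_right) (auto simp: S_def)
    then show ?thesis by simp
  qed
  also have "\<dots> \<le> of_nat 4" using \<open>card S \<le> 4\<close> by (intro of_nat_mono)
  finally show ?thesis by simp
qed

text \<open>Hoelder's inequality with a cruder constant: multiplying the terms by \<open>K\<close>
  makes their average at most \<open>M\<close>, and then \<open>x powr (1/p) \<le> 1 + x\<close>
  applies termwise.\<close>

lemma sum_powr_le_count:
  fixes I :: "nat \<Rightarrow> real"
  assumes "p \<ge> 1" "\<And>k. k < K \<Longrightarrow> 0 \<le> I k" "(\<Sum>k<K. I k) \<le> M"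
  shows "(\<Sum>k<K. I k powr (1/p)) \<le> (1 + M) * real K powr (1 - 1/p)"
proof (cases "K = 0")
  case False
  have key: "x powr (1/p) \<le> 1 + x" if "x \<ge> 0" for x :: real
  proof (cases "x \<le> 1")
    case True
    then have "x powr (1/p) \<le> 1 powr (1/p)" using that assms by (intro powr_mono2) auto
    then show ?thesis using that by simp
  next
    case False
    then have "x powr (1/p) \<le> x powr 1" using assms by (intro powr_mono) auto
    then show ?thesis using that by simp
  qed
  have "(\<Sum>k<K. I k powr (1/p)) = (\<Sum>k<K. real K powr (-(1/p)) * (real K * I k) powr (1/p))"
    using False assms(2) by (intro sum.cong) (auto simp: powr_mult powr_minus)
  also have "\<dots> \<le> (\<Sum>k<K. real K powr (-(1/p)) * (1 + real K * I k))"
    using assms(2) by (intro sum_mono mult_left_mono key) auto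
  also have "\<dots> = real K powr (-(1/p)) * real K * (1 + (\<Sum>k<K. I k))"
    by (simp add: sum.distrib sum_distrib_left sum_distrib_right algebra_simps)
  also have "\<dots> \<le> real K powr (-(1/p)) * real K * (1 + M)"
    using assms(3) by (intro mult_left_mono) auto
  also have "real K powr (-(1/p)) * real K = real K powr (1 - 1/p)"
    using False by (simp add: powr_diff powr_minus field_simps)
  finally show ?thesis by (simp add: mult.commute)
qed simp

text \<open>
  Integrating the growth of the derivative would only give a full logarithm. The better exponent
  comes from Hoelder's inequality over dyadic annuli: across each of them \<open>f\<close> varies by at most the
  \<open>p\<close>-th root of its local energy, and the annuli overlap boundedly, so the energies are summable.
\<close>

lemma growth_log:
  fixes p \<alpha> :: real
  assumes "\<alpha> > -1" "p = \<alpha> + 2"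
  obtains C where "C > 0"
    "\<And>f w. f \<in> dirichlet_space p \<alpha> \<Longrightarrow> dirichlet_norm p \<alpha> f \<le> 1 \<Longrightarrow> w \<in> unit_disk \<Longrightarrow>
      cmod (f w) \<le> C * ln (2 / (1 - (cmod w)\<^sup>2)) powr (1 - 1/p)"
proof -
  have p: "p > 1" using assms by simp
  obtain C where C: "C > 0" "\<And>h w. h holomorphic_on unit_disk \<Longrightarrow> w \<in> unit_disk \<Longrightarrow>
      ennreal (cmod (h w) powr p * (1 - (cmod w)\<^sup>2) powr (\<alpha> + 2))
      \<le> ennreal C * (\<integral>\<^sup>+ z. ennreal (cmod (h z) powr p) * indicator (ball w ((1 - cmod w) / 2)) z \<partial>dA_w \<alpha>)"
    using local_estimate[of p \<alpha>] p by auto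
  \<comment> \<open>The first summand turns the bound \<open>1\<close> for \<open>f 0\<close> into a
    multiple of the logarithm, which is at least \<open>ln 2\<close>. In the second,
    \<open>5\<close> is \<open>1 + M\<close> for total energy \<open>M = 4\<close>, and
    \<open>2 / ln 2\<close> converts the number of annuli into the logarithm.\<close>
  define C' where "C' = (1 / ln 2) powr (1 - 1/p) + 2 * C powr (1/p) * (5 * (2 / ln 2) powr (1 - 1/p))"
  show thesis
  proof (rule that[of C'])
    show "C' > 0" by (simp add: C'_def add_pos_nonneg)
    fix f w assume f: "f \<in> dirichlet_space p \<alpha>" "dirichlet_norm p \<alpha> f \<le> 1" and w: "w \<in> unit_disk"
    note holf = dirichlet_holomorphic[OF f(1)]
    define R where "R = cmod w"
    have R: "0 \<le> R" "R < 1" using w by (auto simp: R_def)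
    let ?\<delta> = "1 - (cmod w)\<^sup>2"
    have \<delta>: "0 < ?\<delta>" "?\<delta> \<le> 1" "?\<delta> / 2 \<le> 1 - R" using one_minus_cmod_bounds[of w] w by (auto simp: R_def)
    obtain \<zeta> where \<zeta>: "cmod \<zeta> = 1" "w = of_real R * \<zeta>" unfolding R_def by (rule unit_direction)
    have ex: "\<exists>K. 1 - 1 / 2 ^ K \<ge> R"
    proof -
      obtain K where "1 / (1 - R) < 2 ^ K" using real_arch_pow[of 2 "1 / (1 - R)"] by auto
      then have "1 - 1 / 2 ^ K \<ge> R" using R by (simp add: field_simps)
      then show ?thesis ..
    qed
    define K where "K = (LEAST K. 1 - 1 / 2 ^ K \<ge> R)"
    have K: "1 - 1 / 2 ^ K \<ge> R" unfolding K_def by (rule LeastI_ex[OF ex])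
    have Kless: "1 - 1 / 2 ^ k < R" if "k < K" for k
      using not_less_Least[of k "\<lambda>K. 1 - 1 / 2 ^ K \<ge> R"] that by (simp add: K_def)
    have Kln: "real K \<le> 2 / ln 2 * ln (2 / ?\<delta>)"
    proof (rule dyadic_count_le_ln[OF \<delta>(1,2)])
      show "K = 0 \<or> 2 ^ (K - 1) < 2 / ?\<delta>"
      proof (cases K)
        case (Suc i)
        then have "1 - R < 1 / 2 ^ i" using Kless[of i] by simp
        then have "?\<delta> / 2 < 1 / 2 ^ i" using \<delta> by linarith
        then have "?\<delta> * 2 ^ i < 2" by (simp add: field_simps)
        then show ?thesis using Suc \<delta> by (simp add: pos_less_divide_eq mult.commute)
      qed simp
    qed
    \<comment> \<open>The annulus is wide enough for the half balls about points with
      \<open>1 - cmod z\<close> between \<open>1 / 2 ^ Suc k\<close> and \<open>1 / 2 ^ k\<close>: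
      on these, that distance shrinks at most to one half and grows at most by
      \<open>3/2\<close>.\<close>
    define A where "A k = {z \<in> unit_disk. 1 - cmod z \<in> {x. 1 / 2 ^ (k + 2) \<le> x \<and> x \<le> 2 / 2 ^ k}}" for k :: nat
    have Ab: "A k \<in> sets (dA_w \<alpha>)" for k
    proof (rule sets_dA_wI)
      show "A k \<in> sets borel" unfolding A_def by simp measurable
    qed (auto simp: A_def)
    define J where "J k = (\<integral>\<^sup>+ z. ennreal (cmod (deriv f z) powr p) * indicator (A k) z \<partial>dA_w \<alpha>)" for k
    have meas: "(\<lambda>z. ennreal (cmod (deriv f z) powr p)) \<in> borel_measurable (dA_w \<alpha>)"
      using holomorphic_on_imp_continuous_on[OF holf(2)] p
      by (intro measurable_compose[OF measurable_dA_w_continuous measurable_ennreal] continuous_intros continuous_on_powr') auto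
    have Jsum: "(\<Sum>k<K. J k) \<le> 4"
    proof -
      have "(\<Sum>k<K. J k) = (\<integral>\<^sup>+ z. (\<Sum>k<K. ennreal (cmod (deriv f z) powr p) * indicator (A k) z) \<partial>dA_w \<alpha>)"
        unfolding J_def using meas Ab by (subst nn_integral_sum) auto
      also have "\<dots> \<le> (\<integral>\<^sup>+ z. ennreal (cmod (deriv f z) powr p) * 4 \<partial>dA_w \<alpha>)"
      proof (intro nn_integral_mono)
        fix z assume z: "z \<in> space (dA_w \<alpha>)"
        have "(\<Sum>k<K. indicator (A k) z) = (\<Sum>k<K. indicator {x. 1 / 2 ^ (k + 2) \<le> x \<and> x \<le> 2 / 2 ^ k} (1 - cmod z) :: ennreal)"
          using z by (intro sum.cong) (auto simp: A_def indicator_def)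
        also have "\<dots> \<le> 4" using z by (intro sum_indicator_dyadic_annuli_le) auto
        finally show "(\<Sum>k<K. ennreal (cmod (deriv f z) powr p) * indicator (A k) z) \<le> ennreal (cmod (deriv f z) powr p) * 4"
          by (simp add: mult_left_mono flip: sum_distrib_left)
      qed
      also have "\<dots> = (\<integral>\<^sup>+ z. ennreal (cmod (deriv f z) powr p) \<partial>dA_w \<alpha>) * 4"
        using meas by (rule nn_integral_multc)
      also have "\<dots> \<le> 1 * 4"
        using dirichlet_norm_le_1D(2)[of p, OF _ f] p by (intro mult_right_mono) auto
      finally show ?thesis by simp
    qed
    have Jfin: "J k < \<infinity>" if "k < K" for k
    proof -
      have "J k \<le> (\<Sum>k<K. J k)" using that by (intro member_le_sum) auto
      with Jsum have "J k \<le> 4" by (rule order_trans[rotated])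
      then show ?thesis by (auto simp: less_top[symmetric] top_unique)
    qed
    define I where "I k = enn2real (J k)" for k
    have I0: "I k \<ge> 0" for k by (simp add: I_def)
    have Jeq: "J k = ennreal (I k)" if "k < K" for k using Jfin[OF that] by (simp add: I_def)
    have Isum: "(\<Sum>k<K. I k) \<le> 4"
    proof -
      have "ennreal (\<Sum>k<K. I k) = (\<Sum>k<K. J k)" using Jeq I0 by (subst sum_ennreal[symmetric]) auto
      also have "\<dots> \<le> ennreal 4" using Jsum by simp
      finally show ?thesis by (simp del: ennreal_numeral)
    qed
    \<comment> \<open>Dyadic radii, truncated so that the last one is exactly
      \<open>cmod w\<close>.\<close>
    define t where "t k = min (1 - 1 / 2 ^ k) R" for k :: nat
    have step: "cmod (f (of_real (t (Suc k)) * \<zeta>) - f (of_real (t k) * \<zeta>)) \<le> 2 * C powr (1/p) * I k powr (1/p)"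
      if k: "k < K" for k
    proof -
      have tk: "t k = 1 - 1 / 2 ^ k" using Kless[OF k] by (simp add: t_def)
      have ts: "t k \<le> t (Suc k)" "t (Suc k) \<le> 1 - 1 / 2 ^ Suc k" "t (Suc k) < 1"
        using Kless[OF k] R by (auto simp: t_def min_def field_simps)
      have t0: "0 \<le> t k" unfolding tk by simp
      \<comment> \<open>On this interval \<open>1 / 2 ^ Suc k\<close> is a lower bound for the
        factor multiplying the derivative. As the interval is no longer than
        \<open>1 / 2 ^ k\<close>, the powers of \<open>2\<close> cancel up to the factor
        \<open>2\<close>.\<close>
      define B where "B = 2 ^ Suc k * (C * I k) powr (1/p)"
      have der: "cmod (deriv f (of_real s * \<zeta>)) \<le> B" if s: "t k \<le> s" "s \<le> t (Suc k)" for s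
      proof -
        have cs: "cmod (of_real s * \<zeta>) = s" using t0 s \<zeta> by (simp add: norm_mult)
        have sd: "of_real s * \<zeta> \<in> unit_disk" using cs s ts by simp
        have s1: "1 / 2 ^ Suc k \<le> 1 - s" "1 - s \<le> 1 / 2 ^ k" using s ts tk by auto
        have sub: "ball (of_real s * \<zeta>) ((1 - cmod (of_real s * \<zeta>)) / 2) \<subseteq> A k"
        proof
          fix z assume "z \<in> ball (of_real s * \<zeta>) ((1 - cmod (of_real s * \<zeta>)) / 2)"
          note b = half_ball_cmod[OF sd this, unfolded cs]
          have "1 / 2 ^ (k + 2) = (1 / 2 ^ Suc k) / (2::real)" by simp
          also have "\<dots> \<le> (1 - s) / 2" using s1(1) by (rule divide_right_mono) simp
          finally have "1 / 2 ^ (k + 2) \<le> 1 - cmod z" using b(1) by linarith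
          moreover have "1 - cmod z \<le> 2 / 2 ^ k"
          proof -
            have "1 - cmod z \<le> 3/2 * (1 / 2 ^ k)"
              by (rule order_trans[OF less_imp_le[OF b(2)] mult_left_mono[OF s1(2)]]) simp
            also have "\<dots> \<le> 2 / 2 ^ k" by (simp add: field_simps)
            finally show ?thesis .
          qed
          moreover have "z \<in> unit_disk" using b(1) s(2) ts(3) by simp
          ultimately show "z \<in> A k" unfolding A_def by blast
        qed
        \<comment> \<open>Criticality enters here: \<open>\<alpha> + 2 = p\<close> puts derivative
          and weight under the same power, so the variation over an annulus is independent of its
          scale.\<close>
        have "ennreal (cmod (deriv f (of_real s * \<zeta>)) powr p * (1 - s\<^sup>2) powr p)
            \<le> ennreal C * (\<integral>\<^sup>+ z. ennreal (cmod (deriv f z) powr p)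
                * indicator (ball (of_real s * \<zeta>) ((1 - cmod (of_real s * \<zeta>)) / 2)) z \<partial>dA_w \<alpha>)"
          using C(2)[OF holf(2) sd] unfolding cs assms(2)[symmetric] .
        also have "\<dots> \<le> ennreal C * J k"
          unfolding J_def using sub by (intro mult_left_mono nn_integral_mono) (auto simp: indicator_def)
        also have "\<dots> = ennreal (C * I k)"
          using C(1) Jeq[OF k] by (simp add: ennreal_mult')
        finally have le: "cmod (deriv f (of_real s * \<zeta>)) powr p * (1 - s\<^sup>2) powr p \<le> C * I k"
          using C(1) I0 by (subst (asm) ennreal_le_iff) auto
        have s2: "1 - s \<le> 1 - s\<^sup>2" "0 < 1 - s"
          using one_minus_cmod_bounds(1)[of "of_real s * \<zeta>"] cs s ts by auto
        have "(cmod (deriv f (of_real s * \<zeta>)) * (1 - s\<^sup>2)) powr p \<le> C * I k"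
          using le s2 by (subst powr_mult) auto
        then have "((cmod (deriv f (of_real s * \<zeta>)) * (1 - s\<^sup>2)) powr p) powr (1/p) \<le> (C * I k) powr (1/p)"
          using p by (intro powr_mono2) auto
        then have "cmod (deriv f (of_real s * \<zeta>)) * (1 - s\<^sup>2) \<le> (C * I k) powr (1/p)"
          using p s2 by (simp add: powr_powr)
        moreover have "cmod (deriv f (of_real s * \<zeta>)) * (1 / 2 ^ Suc k) \<le> cmod (deriv f (of_real s * \<zeta>)) * (1 - s\<^sup>2)"
          using s1 s2 by (intro mult_left_mono) auto
        ultimately have "cmod (deriv f (of_real s * \<zeta>)) * (1 / 2 ^ Suc k) \<le> (C * I k) powr (1/p)" by linarith
        then show ?thesis by (simp add: B_def field_simps)
      qed
      have "cmod (f (of_real (t (Suc k)) * \<zeta>) - f (of_real (t k) * \<zeta>)) \<le> B * t (Suc k) - B * t k"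
      proof (rule radial_segment[where \<Phi> = "\<lambda>s. B * s" and \<Phi>' = "\<lambda>_. B", OF holf(1) t0 ts(1)])
        show "of_real (t (Suc k)) * \<zeta> \<in> unit_disk" using t0 ts \<zeta> by (simp add: norm_mult)
        show "((\<lambda>s. B * s) has_real_derivative B) (at s)" for s
          using DERIV_cmult[OF DERIV_ident, of B] by simp
        show "cmod \<zeta> * cmod (deriv f (of_real s * \<zeta>)) \<le> B" if "t k < s" "s < t (Suc k)" for s
          using der[of s] that \<zeta> by simp
      qed
      also have "\<dots> = B * (t (Suc k) - t k)" by (simp add: algebra_simps)
      also have "B * (t (Suc k) - t k) \<le> B * (1 / 2 ^ k)"
        using ts tk by (intro mult_left_mono) (auto simp: B_def)
      also have "\<dots> = 2 * C powr (1/p) * I k powr (1/p)"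
        using C I0 by (simp add: B_def powr_mult)
      finally show ?thesis .
    qed
    have ind: "n \<le> K \<Longrightarrow> cmod (f (of_real (t n) * \<zeta>)) \<le> 1 + (\<Sum>k<n. 2 * C powr (1/p) * I k powr (1/p))" for n
    proof (induction n)
      case 0
      then show ?case using dirichlet_norm_le_1D(1)[of p, OF _ f] p R by (simp add: t_def)
    next
      case (Suc n)
      then show ?case
        using step[of n] norm_triangle_ineq2[of "f (of_real (t (Suc n)) * \<zeta>)" "f (of_real (t n) * \<zeta>)"] by simp
    qed
    have "t K = R" using K by (simp add: t_def)
    then have "cmod (f w) \<le> 1 + (\<Sum>k<K. 2 * C powr (1/p) * I k powr (1/p))"
      using ind[of K] \<zeta>(2) by simp
    also have "\<dots> = 1 + 2 * C powr (1/p) * (\<Sum>k<K. I k powr (1/p))" by (simp add: sum_distrib_left)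
    also have "(\<Sum>k<K. I k powr (1/p)) \<le> (1 + 4) * real K powr (1 - 1/p)"
      using p I0 Isum by (intro sum_powr_le_count) auto
    also have "real K powr (1 - 1/p) \<le> (2 / ln 2 * ln (2 / ?\<delta>)) powr (1 - 1/p)"
      using Kln p by (intro powr_mono2) auto
    also have "\<dots> = (2 / ln 2) powr (1 - 1/p) * ln (2 / ?\<delta>) powr (1 - 1/p)"
      by (rule powr_mult)
    finally have "cmod (f w) \<le> 1 + 2 * C powr (1/p) * ((1 + 4) * ((2 / ln 2) powr (1 - 1/p) * ln (2 / ?\<delta>) powr (1 - 1/p)))"
      by (simp add: mult_left_mono)
    moreover have "1 \<le> (1 / ln 2) powr (1 - 1/p) * ln (2 / ?\<delta>) powr (1 - 1/p)"
    proof -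
      have l: "ln 2 \<le> ln (2 / ?\<delta>)" using \<delta> by (subst ln_le_cancel_iff) (auto simp: field_simps)
      then have "1 \<le> 1 / ln 2 * ln (2 / ?\<delta>)" by (simp add: field_simps)
      then have "1 \<le> (1 / ln 2 * ln (2 / ?\<delta>)) powr (1 - 1/p)" using p by (intro ge_one_powr_ge_zero) auto
      then show ?thesis by (simp only: powr_mult)
    qed
    ultimately show "cmod (f w) \<le> C' * ln (2 / ?\<delta>) powr (1 - 1/p)"
      unfolding C'_def by (simp add: algebra_simps)
  qed
qed

section \<open>Test functions\<close>

lemma measurable_norm_powr:
  fixes f :: "complex \<Rightarrow> complex"
  assumes "continuous_on unit_disk f" "p > 0"
  shows "(\<lambda>z. ennreal (cmod (f z) powr p)) \<in> borel_measurable (dA_w \<beta>)"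
  using assms
  by (intro measurable_compose[OF measurable_dA_w_continuous measurable_ennreal] continuous_intros continuous_on_powr') auto

lemma measurable_kernel:
  "(\<lambda>z. ennreal (cmod (1 - cnj w * z) powr t)) \<in> borel_measurable (dA_w \<beta>)"
  by (subst measurable_cong_sets[OF sets_dA_w refl], rule measurable_restrict_space1) measurable

lemma has_field_derivative_holomorphic:
  assumes "\<And>z. z \<in> unit_disk \<Longrightarrow> (f has_field_derivative f' z) (at z)"
  shows "f holomorphic_on unit_disk" "f' holomorphic_on unit_disk"
    "\<And>z. z \<in> unit_disk \<Longrightarrow> deriv f z = f' z"
proof -
  show f: "f holomorphic_on unit_disk"
    unfolding holomorphic_on_open[OF open_ball] using assms by blast
  show d: "deriv f z = f' z" if "z \<in> unit_disk" for z
    using assms[OF that] by (rule DERIV_imp_deriv)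
  have "deriv f holomorphic_on unit_disk" by (rule holomorphic_deriv[OF f open_ball])
  then show "f' holomorphic_on unit_disk" by (rule holomorphic_transform) (use d in simp)
qed

text \<open>Division by \<open>K powr (1/p)\<close> multiplies both parts of the \<open>p\<close>-th
  power of the norm by \<open>1 / K\<close>. Only this homogeneity is used, so \<open>p < 1\<close>
  is harmless; the bound on the extended integral also yields membership.\<close>

lemma dirichlet_space_scale:
  assumes "p > 0" "K > 0"
    and der: "\<And>z. z \<in> unit_disk \<Longrightarrow> (f has_field_derivative f' z) (at z)"
    and bound: "ennreal (cmod (f 0) powr p) + (\<integral>\<^sup>+ z. ennreal (cmod (f' z) powr p) \<partial>dA_w \<alpha>) \<le> ennreal K"
  shows "(\<lambda>z. f z / of_real (K powr (1/p))) \<in> dirichlet_space p \<alpha>"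
    "dirichlet_norm p \<alpha> (\<lambda>z. f z / of_real (K powr (1/p))) \<le> 1"
proof -
  define c where "c = K powr (1/p)"
  have c: "c > 0" "c powr p = K" using assms by (auto simp: c_def powr_powr)
  define h where "h = (\<lambda>z. f z / of_real c)"
  have hd: "(h has_field_derivative f' z / of_real c) (at z)" if "z \<in> unit_disk" for z
    unfolding h_def using der[OF that] by (rule DERIV_cdivide)
  note h = has_field_derivative_holomorphic[of h "\<lambda>z. f' z / of_real c", OF hd, simplified]
  note f = has_field_derivative_holomorphic[of f f', OF der, simplified]
  let ?I = "\<integral>\<^sup>+ z. ennreal (cmod (f' z) powr p) \<partial>dA_w \<alpha>"
  have sc: "cmod (x / of_real c) powr p = (1 / K) * cmod x powr p" for x
    using c by (simp add: norm_divide powr_divide)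
  have "(\<integral>\<^sup>+ z. ennreal (cmod (deriv h z) powr p) \<partial>dA_w \<alpha>)
      = (\<integral>\<^sup>+ z. ennreal (1 / K) * ennreal (cmod (f' z) powr p) \<partial>dA_w \<alpha>)"
    using assms h(3) by (intro nn_integral_cong) (simp add: sc del: times_divide_eq_left flip: ennreal_mult')
  also have "\<dots> = ennreal (1 / K) * ?I"
    using holomorphic_on_imp_continuous_on[OF f(2)] assms
    by (intro nn_integral_cmult measurable_norm_powr) auto
  finally have hI: "(\<integral>\<^sup>+ z. ennreal (cmod (deriv h z) powr p) \<partial>dA_w \<alpha>) = ennreal (1 / K) * ?I" .
  have "?I \<le> ennreal K" using bound by (meson add_increasing order_trans le_add_same_cancel2 zero_le order_refl add_left_mono)
  then have If: "?I < \<infinity>" by (auto intro: le_less_trans)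
  then have hf: "ennreal (1 / K) * ?I < \<infinity>" by (simp add: ennreal_mult_less_top)
  have "h \<in> dirichlet_space p \<alpha>"
    using h(1) hf hI by (simp add: dirichlet_space_def finite_int_def)
  moreover have "dirichlet_norm p \<alpha> h \<le> 1"
  proof -
    define i where "i = enn2real ?I"
    have i: "?I = ennreal i" "i \<ge> 0" using If by (auto simp: i_def)
    have "cmod (f 0) powr p + i \<le> K"
      using bound assms i by (simp add: i(1) flip: ennreal_plus)
    then have "(1 / K) * (cmod (f 0) powr p + i) \<le> (1 / K) * K"
      using assms by (intro mult_left_mono) auto
    then have "cmod (h 0) powr p + 1 / K * i \<le> 1"
      using assms unfolding h_def sc by (simp add: distrib_left)
    moreover have "enn2real (ennreal (1 / K) * ?I) = 1 / K * i"
      using i assms by (simp add: enn2real_mult)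
    ultimately have "(cmod (h 0) powr p + enn2real (ennreal (1 / K) * ?I)) powr (1/p) \<le> 1 powr (1/p)"
      using assms i by (intro powr_mono2) auto
    then show ?thesis unfolding dirichlet_norm_def hI by simp
  qed
  ultimately show "(\<lambda>z. f z / of_real (K powr (1/p))) \<in> dirichlet_space p \<alpha>"
    "dirichlet_norm p \<alpha> (\<lambda>z. f z / of_real (K powr (1/p))) \<le> 1"
    unfolding h_def c_def by auto
qed

lemma deriv_wcomp:
  assumes "u holomorphic_on unit_disk" "\<phi> holomorphic_on unit_disk" "\<phi> ` unit_disk \<subseteq> unit_disk"
    and "z \<in> unit_disk" "(f has_field_derivative d) (at (\<phi> z))"
  shows "deriv (wcomp u \<phi> f) z = deriv u z * f (\<phi> z) + u z * deriv \<phi> z * d"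
proof -
  have u: "(u has_field_derivative deriv u z) (at z)" and ph: "(\<phi> has_field_derivative deriv \<phi> z) (at z)"
    using assms by (auto intro: holomorphic_derivI)
  have "((\<lambda>z. u z * f (\<phi> z)) has_field_derivative deriv u z * f (\<phi> z) + d * deriv \<phi> z * u z) (at z)"
    by (rule DERIV_mult[OF u DERIV_chain2[OF assms(5) ph]])
  then show ?thesis unfolding wcomp_def by (auto simp: mult_ac dest!: DERIV_imp_deriv)
qed

section \<open>Necessity: testing a dominating function\<close>

text \<open>Only the pointwise side of order boundedness is recorded. Each test yields an almost
  everywhere bound by a multiple of \<open>g\<close>; the integrability of \<open>g\<close> is
  applied to these bounds afterwards.\<close>

locale order_bound_witness =
  fixes p \<alpha> \<beta> :: real and u \<phi> :: "complex \<Rightarrow> complex" and g :: "complex \<Rightarrow> real"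
  assumes p: "p > 0" and \<alpha>: "\<alpha> > -1"
    and u: "u holomorphic_on unit_disk"
    and \<phi>: "\<phi> holomorphic_on unit_disk" and self_map: "\<phi> ` unit_disk \<subseteq> unit_disk"
    and witness: "\<And>f. f \<in> dirichlet_space p \<alpha> \<Longrightarrow> dirichlet_norm p \<alpha> f \<le> 1 \<Longrightarrow>
      (AE z in dA_w \<beta>. cmod (deriv (wcomp u \<phi> f) z) \<le> g z)"
begin

text \<open>
  The exceptional null set of the witness depends on the test function; testing with a countable
  dense set of parameters \<open>w\<close> and using continuity in \<open>w\<close> allows \<open>w\<close> to depend on \<open>z\<close>.
\<close>

lemma test_family:
  assumes K: "K > 0"
    and der: "\<And>w z. w \<in> unit_disk \<Longrightarrow> z \<in> unit_disk \<Longrightarrow> (T w has_field_derivative T' w z) (at z)"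
    and bound: "\<And>w. w \<in> unit_disk \<Longrightarrow>
      ennreal (cmod (T w 0) powr p) + (\<integral>\<^sup>+ z. ennreal (cmod (T' w z) powr p) \<partial>dA_w \<alpha>) \<le> ennreal K"
    and cont: "\<And>z. z \<in> unit_disk \<Longrightarrow> continuous_on unit_disk (\<lambda>w. T w z)"
      "\<And>z. z \<in> unit_disk \<Longrightarrow> continuous_on unit_disk (\<lambda>w. T' w z)"
  shows "AE z in dA_w \<beta>. cmod (deriv u z * T (\<phi> z) (\<phi> z) + u z * deriv \<phi> z * T' (\<phi> z) (\<phi> z))
    \<le> K powr (1/p) * g z"
proof -
  define c where "c = K powr (1/p)"
  have c: "c > 0" using K by (simp add: c_def)
  define F where "F w z = cmod (deriv u z * T w (\<phi> z) + u z * deriv \<phi> z * T' w (\<phi> z))" for w z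
  have ph: "\<phi> z \<in> unit_disk" if "z \<in> unit_disk" for z using self_map that by blast
  have each: "AE z in dA_w \<beta>. F w z \<le> c * g z" if w: "w \<in> unit_disk" for w
  proof -
    note s = dirichlet_space_scale[OF p K der[OF w] bound[OF w], folded c_def]
    have "AE z in dA_w \<beta>. cmod (deriv (wcomp u \<phi> (\<lambda>z. T w z / of_real c)) z) \<le> g z"
      by (rule witness) (use s in auto)
    moreover have "AE z in dA_w \<beta>. z \<in> unit_disk" using AE_space[of "dA_w \<beta>"] by simp
    ultimately show ?thesis
    proof eventually_elim
      fix z assume le: "cmod (deriv (wcomp u \<phi> (\<lambda>z. T w z / of_real c)) z) \<le> g z" and z: "z \<in> unit_disk"
      have "((\<lambda>z. T w z / of_real c) has_field_derivative T' w (\<phi> z) / of_real c) (at (\<phi> z))"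
        using der[OF w ph[OF z]] by (rule DERIV_cdivide)
      then have "deriv (wcomp u \<phi> (\<lambda>z. T w z / of_real c)) z
          = deriv u z * (T w (\<phi> z) / of_real c) + u z * deriv \<phi> z * (T' w (\<phi> z) / of_real c)"
        by (rule deriv_wcomp[OF u \<phi> self_map z])
      also have "\<dots> = (deriv u z * T w (\<phi> z) + u z * deriv \<phi> z * T' w (\<phi> z)) / of_real c"
        by (simp add: add_divide_distrib)
      finally have "F w z / c \<le> g z" using le c by (simp add: norm_divide F_def)
      then show "F w z \<le> c * g z" using c by (simp add: field_simps)
    qed
  qed
  obtain Q :: "complex set" where Q: "countable Q" "\<And>X. open X \<Longrightarrow> X \<noteq> {} \<Longrightarrow> \<exists>d\<in>Q. d \<in> X"
    using countable_dense_setE by blast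
  have "AE z in dA_w \<beta>. \<forall>w\<in>Q \<inter> unit_disk. F w z \<le> c * g z"
    using each Q(1) by (intro AE_ball_countable') auto
  moreover have "AE z in dA_w \<beta>. z \<in> unit_disk" using AE_space[of "dA_w \<beta>"] by simp
  ultimately have "AE z in dA_w \<beta>. F (\<phi> z) z \<le> c * g z"
  proof eventually_elim
    fix z assume le: "\<forall>w\<in>Q \<inter> unit_disk. F w z \<le> c * g z" and z: "z \<in> unit_disk"
    show "F (\<phi> z) z \<le> c * g z"
    proof (rule ccontr)
      assume "\<not> F (\<phi> z) z \<le> c * g z"
      then have "\<phi> z \<in> unit_disk \<inter> (\<lambda>w. F w z) -` {c * g z<..}" using ph[OF z] by auto
      moreover have "continuous_on unit_disk (\<lambda>w. F w z)"
        unfolding F_def using cont[OF ph[OF z]] by (intro continuous_intros)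
      then have "open (unit_disk \<inter> (\<lambda>w. F w z) -` {c * g z<..})"
        by (rule continuous_open_preimage) auto
      ultimately obtain d where "d \<in> Q" "d \<in> unit_disk \<inter> (\<lambda>w. F w z) -` {c * g z<..}"
        using Q(2) by blast
      with le show False by force
    qed
  qed
  then show ?thesis unfolding F_def c_def .
qed

text \<open>Besides the whole estimate of \<open>deriv u\<close> for
  \<open>p > \<alpha> + 2\<close>, this provides \<open>g z \<ge> 0\<close> almost everywhere, which
  is needed whenever a constant in front of \<open>g\<close> is enlarged.\<close>

lemma test_const: "AE z in dA_w \<beta>. cmod (deriv u z) \<le> g z"
  using test_family[of 1 "\<lambda>_ _. 1" "\<lambda>_ _. 0"] by simp

text \<open>The energy of the identity is the mass of the disk, finite because
  \<open>\<alpha> > -1\<close>.\<close>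

lemma test_id: "\<exists>K>0. AE z in dA_w \<beta>. cmod (deriv u z * \<phi> z + u z * deriv \<phi> z) \<le> K * g z"
proof -
  define K where "K = enn2real (emeasure (dA_w \<alpha>) unit_disk) + 1"
  have K: "K > 0" by (simp add: K_def add_nonneg_pos)
  have "emeasure (dA_w \<alpha>) unit_disk = ennreal (enn2real (emeasure (dA_w \<alpha>) unit_disk))"
    using emeasure_dA_w_disk_finite[OF \<alpha>] by simp
  also have "\<dots> \<le> ennreal K" by (intro ennreal_leI) (simp add: K_def)
  finally have "AE z in dA_w \<beta>. cmod (deriv u z * \<phi> z + u z * deriv \<phi> z * 1) \<le> K powr (1/p) * g z"
    using p emeasure_space[of "dA_w \<alpha>"]
    by (intro test_family[where T = "\<lambda>_ z. z" and T' = "\<lambda>_ _. 1"] K) (auto intro!: continuous_intros)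
  then show ?thesis using K by (intro exI[of _ "K powr (1/p)"]) auto
qed

text \<open>The kernel with parameter \<open>w\<close> is evaluated at \<open>w = \<phi> z\<close>,
  where \<open>1 - cnj w * z\<close> becomes \<open>\<delta>\<close>. The order \<open>M\<close>
  survives only as a factor of the derivative term. The condition \<open>M + 1 > s\<close> is
  convergence of the kernel integral for the derivative.\<close>

lemma test_power:
  fixes M :: nat
  defines "s \<equiv> (\<alpha> + 2) / p"
  assumes M: "M \<ge> 1" "real M + 1 > s"
  shows "\<exists>K>0. AE z in dA_w \<beta>.
    cmod (deriv u z * of_real ((1 - (cmod (\<phi> z))\<^sup>2) powr (1 - s))
      + u z * deriv \<phi> z * (of_nat M * cnj (\<phi> z) * of_real ((1 - (cmod (\<phi> z))\<^sup>2) powr (- s)))) \<le> K * g z"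
proof -
  define m where "m = real M + 1"
  have ps: "p * s = \<alpha> + 2" using p by (simp add: s_def)
  have mp: "m * p > \<alpha> + 2" using M(2) p by (simp add: m_def s_def field_simps)
  obtain C where C: "C > 0"
    "\<And>w. w \<in> unit_disk \<Longrightarrow> (\<integral>\<^sup>+ z. ennreal (cmod (1 - cnj w * z) powr (-(m * p))) \<partial>dA_w \<alpha>)
      \<le> ennreal (C * (1 - (cmod w)\<^sup>2) powr (\<alpha> + 2 - m * p))"
    using kernel_integral_power[OF \<alpha> mp] by blast
  \<comment> \<open>The \<open>1\<close> bounds the value at \<open>0\<close>, since
    \<open>m > s\<close> and \<open>\<delta> \<le> 1\<close>. The rest bounds the energy: the powers
    of \<open>\<delta>\<close> from normalization and kernel integral cancel.\<close>
  define K where "K = 1 + real M powr p * C"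
  have K: "K > 0" using C by (simp add: K_def add_pos_nonneg)
  define T where "T w z = of_real ((1 - (cmod w)\<^sup>2) powr (m - s)) / (1 - cnj w * z) ^ M" for w z
  define T' where "T' w z = of_nat M * cnj w * of_real ((1 - (cmod w)\<^sup>2) powr (m - s)) / (1 - cnj w * z) ^ Suc M" for w z
  have nz: "1 - cnj w * z \<noteq> 0" if "w \<in> unit_disk" "z \<in> unit_disk" for w z
    using one_minus_cnj_mult_bounds(1)[OF that] that by auto
  have \<delta>: "0 < 1 - (cmod w)\<^sup>2" "1 - (cmod w)\<^sup>2 \<le> 1" if "w \<in> unit_disk" for w :: complex
    using one_minus_cmod_bounds[of w] that by auto
  have "AE z in dA_w \<beta>. cmod (deriv u z * T (\<phi> z) (\<phi> z) + u z * deriv \<phi> z * T' (\<phi> z) (\<phi> z)) \<le> K powr (1/p) * g z"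
  proof (rule test_family[where T = T and T' = T', OF K])
    fix w z assume w: "w \<in> unit_disk" and z: "z \<in> unit_disk"
    have "((\<lambda>z. (1 - cnj w * z) ^ M) has_field_derivative of_nat M * (1 - cnj w * z) ^ (M - 1) * (- cnj w)) (at z)"
      by (auto intro!: derivative_eq_intros)
    from DERIV_divide[OF DERIV_const this, of "of_real ((1 - (cmod w)\<^sup>2) powr (m - s))"] nz[OF w z]
    have "(T w has_field_derivative
        - (of_real ((1 - (cmod w)\<^sup>2) powr (m - s)) * (of_nat M * (1 - cnj w * z) ^ (M - 1) * (- cnj w)))
          / ((1 - cnj w * z) ^ M * (1 - cnj w * z) ^ M)) (at z)"
      unfolding T_def by simp
    moreover have "- (of_real ((1 - (cmod w)\<^sup>2) powr (m - s)) * (of_nat M * (1 - cnj w * z) ^ (M - 1) * (- cnj w)))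
          / ((1 - cnj w * z) ^ M * (1 - cnj w * z) ^ M) = T' w z"
    proof -
      \<comment> \<open>With \<open>P\<close> for the power of order \<open>M - 1\<close> the
        quotient rule reduces to a rational identity without exponents.\<close>
      have cancel: "- (a * (n * P * (- b))) / ((P * y) * (P * y)) = n * b * a / (y * (P * y))"
        if "P \<noteq> 0" "y \<noteq> 0" for a n P b y :: complex
        using that by (simp add: field_simps)
      have "(1 - cnj w * z) ^ M = (1 - cnj w * z) ^ (M - 1) * (1 - cnj w * z)"
        using M(1) by (cases M) (auto simp: mult.commute)
      then show ?thesis
        using cancel[of "(1 - cnj w * z) ^ (M - 1)" "1 - cnj w * z"] nz[OF w z]
        unfolding T'_def power_Suc by (simp only: power_not_zero not_False_eq_True)
    qed
    ultimately show "(T w has_field_derivative T' w z) (at z)" by simp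
  next
    fix w assume w: "w \<in> unit_disk"
    let ?\<delta> = "1 - (cmod w)\<^sup>2"
    have t0: "cmod (T w 0) powr p \<le> 1"
    proof -
      have "?\<delta> powr (m - s) \<le> 1" using \<delta>[OF w] M by (intro powr_le1) (auto simp: m_def)
      then have "(?\<delta> powr (m - s)) powr p \<le> 1" using p by (intro powr_le1) auto
      then show ?thesis by (simp add: T_def)
    qed
    have pw: "cmod (T' w z) powr p \<le> (real M powr p * ?\<delta> powr (m * p - (\<alpha> + 2))) * cmod (1 - cnj w * z) powr (-(m * p))"
      if z: "z \<in> unit_disk" for z
    proof -
      have pos: "cmod (1 - cnj w * z) > 0" using nz[OF w z] by simp
      have "cmod (T' w z) = real M * cmod w * ?\<delta> powr (m - s) * cmod (1 - cnj w * z) powr (- m)"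
      proof -
        have "m = real (Suc M)" by (simp add: m_def)
        then have "cmod (1 - cnj w * z) powr (- m) = inverse (cmod (1 - cnj w * z) ^ Suc M)"
          using pos by (simp only: powr_minus powr_realpow)
        then show ?thesis
          by (simp add: T'_def norm_mult norm_divide norm_power norm_inverse divide_inverse del: power_Suc)
      qed
      also have "\<dots> \<le> real M * 1 * ?\<delta> powr (m - s) * cmod (1 - cnj w * z) powr (- m)"
        using w by (intro mult_right_mono mult_left_mono) auto
      finally have "cmod (T' w z) powr p \<le> (real M * 1 * ?\<delta> powr (m - s) * cmod (1 - cnj w * z) powr (- m)) powr p"
        using p by (intro powr_mono2) auto
      also have "\<dots> = (real M powr p * ?\<delta> powr (m * p - (\<alpha> + 2))) * cmod (1 - cnj w * z) powr (-(m * p))"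
      proof -
        have "(m - s) * p = m * p - (\<alpha> + 2)" using ps by (simp add: algebra_simps)
        then show ?thesis by (simp add: powr_mult powr_powr)
      qed
      finally show ?thesis .
    qed
    have "(\<integral>\<^sup>+ z. ennreal (cmod (T' w z) powr p) \<partial>dA_w \<alpha>)
        \<le> (\<integral>\<^sup>+ z. ennreal (real M powr p * ?\<delta> powr (m * p - (\<alpha> + 2))) * ennreal (cmod (1 - cnj w * z) powr (-(m * p))) \<partial>dA_w \<alpha>)"
      using pw by (intro nn_integral_mono) (auto intro!: ennreal_leI simp flip: ennreal_mult')
    also have "\<dots> = ennreal (real M powr p * ?\<delta> powr (m * p - (\<alpha> + 2))) * (\<integral>\<^sup>+ z. ennreal (cmod (1 - cnj w * z) powr (-(m * p))) \<partial>dA_w \<alpha>)"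
      by (rule nn_integral_cmult[OF measurable_kernel])
    also have "\<dots> \<le> ennreal (real M powr p * ?\<delta> powr (m * p - (\<alpha> + 2))) * ennreal (C * ?\<delta> powr (\<alpha> + 2 - m * p))"
      by (intro mult_left_mono C w) auto
    also have "\<dots> = ennreal (real M powr p * C)"
    proof -
      have "?\<delta> powr (m * p - (\<alpha> + 2)) * ?\<delta> powr (\<alpha> + 2 - m * p) = 1"
        using \<delta>[OF w] by (simp flip: powr_add)
      then have "real M powr p * ?\<delta> powr (m * p - (\<alpha> + 2)) * (C * ?\<delta> powr (\<alpha> + 2 - m * p)) = real M powr p * C"
        by (simp add: mult_ac)
      then show ?thesis by (metis ennreal_mult' mult_nonneg_nonneg powr_ge_zero)
    qed
    finally have "ennreal (cmod (T w 0) powr p) + (\<integral>\<^sup>+ z. ennreal (cmod (T' w z) powr p) \<partial>dA_w \<alpha>)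
        \<le> ennreal 1 + ennreal (real M powr p * C)"
      using t0 by (intro add_mono ennreal_leI) auto
    also have "\<dots> = ennreal K" unfolding K_def using C by (subst ennreal_plus) auto
    finally show "ennreal (cmod (T w 0) powr p) + (\<integral>\<^sup>+ z. ennreal (cmod (T' w z) powr p) \<partial>dA_w \<alpha>) \<le> ennreal K" .
  next
    fix z assume z: "z \<in> unit_disk"
    show "continuous_on unit_disk (\<lambda>w. T w z)" "continuous_on unit_disk (\<lambda>w. T' w z)"
      unfolding T_def T'_def using nz[OF _ z] \<delta> by (auto intro!: continuous_intros simp: less_imp_neq[symmetric])
  qed
  moreover have "AE z in dA_w \<beta>. z \<in> unit_disk" using AE_space[of "dA_w \<beta>"] by simp
  ultimately have "AE z in dA_w \<beta>.
    cmod (deriv u z * of_real ((1 - (cmod (\<phi> z))\<^sup>2) powr (1 - s))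
      + u z * deriv \<phi> z * (of_nat M * cnj (\<phi> z) * of_real ((1 - (cmod (\<phi> z))\<^sup>2) powr (- s)))) \<le> K powr (1/p) * g z"
  proof eventually_elim
    fix z assume le: "cmod (deriv u z * T (\<phi> z) (\<phi> z) + u z * deriv \<phi> z * T' (\<phi> z) (\<phi> z)) \<le> K powr (1/p) * g z"
      and z: "z \<in> unit_disk"
    let ?\<delta> = "1 - (cmod (\<phi> z))\<^sup>2"
    have d: "?\<delta> > 0" using \<delta>(1)[of "\<phi> z"] self_map z by blast
    have e: "1 - cnj (\<phi> z) * \<phi> z = of_real ?\<delta>"
      unfolding of_real_diff complex_norm_square by (simp add: mult.commute)
    have "T (\<phi> z) (\<phi> z) = of_real (?\<delta> powr (m - s) / ?\<delta> ^ M)"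
      unfolding T_def e by simp
    also have "?\<delta> powr (m - s) / ?\<delta> ^ M = ?\<delta> powr (1 - s)"
      using d by (simp add: m_def powr_diff powr_add powr_realpow)
    finally have 1: "T (\<phi> z) (\<phi> z) = of_real (?\<delta> powr (1 - s))" .
    have "T' (\<phi> z) (\<phi> z) = of_nat M * cnj (\<phi> z) * of_real (?\<delta> powr (m - s) / ?\<delta> ^ Suc M)"
      unfolding T'_def e by simp
    also have "?\<delta> powr (m - s) / ?\<delta> ^ Suc M = ?\<delta> powr (- s)"
    proof -
      have "m = real (Suc M)" by (simp add: m_def)
      then have "?\<delta> ^ Suc M = ?\<delta> powr m" using d by (simp only: powr_realpow)
      then show ?thesis by (simp flip: powr_diff)
    qed
    finally have 2: "T' (\<phi> z) (\<phi> z) = of_nat M * cnj (\<phi> z) * of_real (?\<delta> powr (- s))" .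
    show "cmod (deriv u z * of_real (?\<delta> powr (1 - s))
      + u z * deriv \<phi> z * (of_nat M * cnj (\<phi> z) * of_real (?\<delta> powr (- s)))) \<le> K powr (1/p) * g z"
      using le unfolding 1 2 .
  qed
  then show ?thesis using K by (intro exI[of _ "K powr (1/p)"]) auto
qed

text \<open>The energy of the unnormalized logarithm is at most a multiple of \<open>L w\<close>,
  which forces the factor \<open>L w powr (-1/p)\<close> and leaves
  \<open>L w powr (1 - 1/p)\<close> at the parameter itself.\<close>

lemma test_log:
  assumes crit: "p = \<alpha> + 2"
  shows "\<exists>K>0. AE z in dA_w \<beta>.
    cmod (deriv u z * of_real (ln (2 / (1 - (cmod (\<phi> z))\<^sup>2)) powr (1 - 1/p))
      + u z * deriv \<phi> z * (of_real (ln (2 / (1 - (cmod (\<phi> z))\<^sup>2)) powr (-1/p)) * cnj (\<phi> z)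
          / of_real (1 - (cmod (\<phi> z))\<^sup>2))) \<le> K * g z"
proof -
  obtain C where C: "C > 0"
    "\<And>w. w \<in> unit_disk \<Longrightarrow> (\<integral>\<^sup>+ z. ennreal (cmod (1 - cnj w * z) powr (-p)) \<partial>dA_w \<alpha>)
      \<le> ennreal (C * ln (2 / (1 - (cmod w)\<^sup>2)))"
    using kernel_integral_log[OF \<alpha>] unfolding crit by blast
  \<comment> \<open>The first summand bounds the value at \<open>0\<close>, where the test function
    is \<open>ln 2\<close> times the normalization and \<open>L w \<ge> ln 2\<close>.\<close>
  define K where "K = ln 2 powr p / ln 2 + C"
  have K: "K > 0" using C by (simp add: K_def add_nonneg_pos)
  define L where "L w = ln (2 / (1 - (cmod w)\<^sup>2))" for w :: complex
  define T where "T w z = of_real (L w powr (-1/p)) * (of_real (ln 2) - Ln (1 - cnj w * z))" for w z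
  define T' where "T' w z = of_real (L w powr (-1/p)) * cnj w / (1 - cnj w * z)" for w z
  \<comment> \<open>The argument of \<open>Ln\<close> stays in the right half plane, away from the
    branch cut.\<close>
  have re: "Re (1 - cnj w * z) > 0" if "w \<in> unit_disk" "z \<in> unit_disk" for w z
  proof -
    have "cmod w * cmod z < 1" using that mult_strict_mono[of "cmod w" 1 "cmod z" 1] by auto
    then show ?thesis using complex_Re_le_cmod[of "cnj w * z"] by (simp add: norm_mult)
  qed
  have nz: "1 - cnj w * z \<noteq> 0" if "w \<in> unit_disk" "z \<in> unit_disk" for w z
    using re[OF that] by (metis less_irrefl zero_complex.simps(1))
  have nn: "1 - cnj w * z \<notin> \<real>\<^sub>\<le>\<^sub>0" if "w \<in> unit_disk" "z \<in> unit_disk" for w z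
    using re[OF that] by (auto simp: complex_nonpos_Reals_iff)
  have \<delta>: "0 < 1 - (cmod w)\<^sup>2" "1 - (cmod w)\<^sup>2 \<le> 1" if "w \<in> unit_disk" for w :: complex
    using one_minus_cmod_bounds[of w] that by auto
  have L: "ln 2 \<le> L w" "0 < L w" if "w \<in> unit_disk" for w
  proof -
    show "ln 2 \<le> L w" unfolding L_def using \<delta>[OF that] by (subst ln_le_cancel_iff) (auto simp: field_simps)
    then show "0 < L w" by (rule less_le_trans[rotated]) simp
  qed
  have "AE z in dA_w \<beta>. cmod (deriv u z * T (\<phi> z) (\<phi> z) + u z * deriv \<phi> z * T' (\<phi> z) (\<phi> z)) \<le> K powr (1/p) * g z"
  proof (rule test_family[where T = T and T' = T', OF K])
    fix w z assume w: "w \<in> unit_disk" and z: "z \<in> unit_disk"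
    have "((\<lambda>z. Ln (1 - cnj w * z)) has_field_derivative - cnj w / (1 - cnj w * z)) (at z)"
      using nn[OF w z] by (auto intro!: derivative_eq_intros simp: divide_inverse)
    from DERIV_cmult[OF DERIV_diff[OF DERIV_const this], of "of_real (L w powr (-1/p))" "of_real (ln 2)"]
    show "(T w has_field_derivative T' w z) (at z)"
      unfolding T_def T'_def by simp
  next
    fix w assume w: "w \<in> unit_disk"
    have "(L w powr (-1/p)) powr p = L w powr (-1)" using p by (simp add: powr_powr)
    also have "\<dots> = 1 / L w" using L[OF w] by (simp add: powr_minus divide_inverse)
    finally have Lp: "(L w powr (-1/p)) powr p = 1 / L w" .
    have "cmod (T w 0) = L w powr (-1/p) * ln 2" by (simp add: T_def norm_mult)
    then have "cmod (T w 0) powr p = ln 2 powr p / L w" using Lp by (simp add: powr_mult)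
    also have "\<dots> \<le> ln 2 powr p / ln 2" using L[OF w] by (intro divide_left_mono) auto
    finally have t0: "cmod (T w 0) powr p \<le> ln 2 powr p / ln 2" .
    have pw: "cmod (T' w z) powr p \<le> 1 / L w * cmod (1 - cnj w * z) powr (-p)" if z: "z \<in> unit_disk" for z
    proof -
      have pos: "cmod (1 - cnj w * z) > 0" using nz[OF w z] by simp
      have "cmod (T' w z) = L w powr (-1/p) * cmod w * cmod (1 - cnj w * z) powr (-1)"
        using pos by (simp add: T'_def norm_mult norm_divide norm_inverse powr_minus divide_inverse)
      also have "\<dots> \<le> L w powr (-1/p) * 1 * cmod (1 - cnj w * z) powr (-1)"
        using w by (intro mult_right_mono mult_left_mono) auto
      finally have "cmod (T' w z) powr p \<le> (L w powr (-1/p) * 1 * cmod (1 - cnj w * z) powr (-1)) powr p"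
        using p by (intro powr_mono2) auto
      also have "\<dots> = (L w powr (-1/p)) powr p * cmod (1 - cnj w * z) powr (-p)"
        by (simp only: powr_mult powr_powr mult_1_right mult_minus1)
      finally show ?thesis unfolding Lp .
    qed
    have "(\<integral>\<^sup>+ z. ennreal (cmod (T' w z) powr p) \<partial>dA_w \<alpha>)
        \<le> (\<integral>\<^sup>+ z. ennreal (1 / L w) * ennreal (cmod (1 - cnj w * z) powr (-p)) \<partial>dA_w \<alpha>)"
    proof (rule nn_integral_mono)
      fix z assume "z \<in> space (dA_w \<alpha>)"
      then have "ennreal (cmod (T' w z) powr p) \<le> ennreal (1 / L w * cmod (1 - cnj w * z) powr (-p))"
        using pw by (intro ennreal_leI) simp
      also have "\<dots> = ennreal (1 / L w) * ennreal (cmod (1 - cnj w * z) powr (-p))"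
        using L[OF w] by (intro ennreal_mult) auto
      finally show "ennreal (cmod (T' w z) powr p) \<le> ennreal (1 / L w) * ennreal (cmod (1 - cnj w * z) powr (-p))" .
    qed
    also have "\<dots> = ennreal (1 / L w) * (\<integral>\<^sup>+ z. ennreal (cmod (1 - cnj w * z) powr (-p)) \<partial>dA_w \<alpha>)"
      by (rule nn_integral_cmult[OF measurable_kernel])
    also have "\<dots> \<le> ennreal (1 / L w) * ennreal (C * L w)"
      unfolding L_def by (intro mult_left_mono C w) auto
    also have "\<dots> = ennreal (1 / L w * (C * L w))"
      using C L[OF w] by (intro ennreal_mult[symmetric]) auto
    also have "1 / L w * (C * L w) = C" using L[OF w] by simp
    finally have "ennreal (cmod (T w 0) powr p) + (\<integral>\<^sup>+ z. ennreal (cmod (T' w z) powr p) \<partial>dA_w \<alpha>)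
        \<le> ennreal (ln 2 powr p / ln 2) + ennreal C"
      using t0 by (intro add_mono ennreal_leI) auto
    also have "\<dots> = ennreal K" unfolding K_def using C by (subst ennreal_plus) auto
    finally show "ennreal (cmod (T w 0) powr p) + (\<integral>\<^sup>+ z. ennreal (cmod (T' w z) powr p) \<partial>dA_w \<alpha>) \<le> ennreal K" .
  next
    fix z assume z: "z \<in> unit_disk"
    have "continuous_on unit_disk L"
      unfolding L_def using \<delta> by (intro continuous_intros) (auto simp: less_imp_neq[symmetric])
    then have Lc: "continuous_on unit_disk (\<lambda>w. L w powr (-1/p))"
      using L(2) by (intro continuous_intros) (auto simp: less_imp_neq[symmetric])
    show "continuous_on unit_disk (\<lambda>w. T w z)"
      unfolding T_def using nn[OF _ z] by (intro continuous_intros Lc) auto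
    show "continuous_on unit_disk (\<lambda>w. T' w z)"
      unfolding T'_def using nz[OF _ z] by (intro continuous_intros Lc) auto
  qed
  moreover have "AE z in dA_w \<beta>. z \<in> unit_disk" using AE_space[of "dA_w \<beta>"] by simp
  ultimately have "AE z in dA_w \<beta>.
    cmod (deriv u z * of_real (ln (2 / (1 - (cmod (\<phi> z))\<^sup>2)) powr (1 - 1/p))
      + u z * deriv \<phi> z * (of_real (ln (2 / (1 - (cmod (\<phi> z))\<^sup>2)) powr (-1/p)) * cnj (\<phi> z)
          / of_real (1 - (cmod (\<phi> z))\<^sup>2))) \<le> K powr (1/p) * g z"
  proof eventually_elim
    fix z assume le: "cmod (deriv u z * T (\<phi> z) (\<phi> z) + u z * deriv \<phi> z * T' (\<phi> z) (\<phi> z)) \<le> K powr (1/p) * g z"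
      and z: "z \<in> unit_disk"
    let ?\<delta> = "1 - (cmod (\<phi> z))\<^sup>2"
    have ph: "\<phi> z \<in> unit_disk" using self_map z by blast
    have d: "?\<delta> > 0" using \<delta>(1)[OF ph] .
    have e: "1 - cnj (\<phi> z) * \<phi> z = of_real ?\<delta>"
      unfolding of_real_diff complex_norm_square by (simp add: mult.commute)
    have "T (\<phi> z) (\<phi> z) = of_real (L (\<phi> z) powr (-1/p) * (ln 2 - ln ?\<delta>))"
      unfolding T_def e Ln_of_real[OF d] by simp
    also have "ln 2 - ln ?\<delta> = L (\<phi> z)" using d by (simp add: L_def ln_div)
    also have "L (\<phi> z) powr (-1/p) * L (\<phi> z) = L (\<phi> z) powr (1 - 1/p)"
      using L(2)[OF ph] by (simp add: powr_diff powr_minus divide_inverse)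
    finally have 1: "T (\<phi> z) (\<phi> z) = of_real (L (\<phi> z) powr (1 - 1/p))" .
    have 2: "T' (\<phi> z) (\<phi> z) = of_real (L (\<phi> z) powr (-1/p)) * cnj (\<phi> z) / of_real ?\<delta>"
      unfolding T'_def e ..
    show "cmod (deriv u z * of_real (ln (2 / ?\<delta>) powr (1 - 1/p))
      + u z * deriv \<phi> z * (of_real (ln (2 / ?\<delta>) powr (-1/p)) * cnj (\<phi> z) / of_real ?\<delta>)) \<le> K powr (1/p) * g z"
      using le unfolding 1 2 L_def .
  qed
  then show ?thesis using K by (intro exI[of _ "K powr (1/p)"]) auto
qed

text \<open>The tests of orders \<open>M\<close> and \<open>M + 1\<close> bound
  \<open>x + M * y\<close> and \<open>x + (M + 1) * y\<close>. Their difference is \<open>y\<close>,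
  and then \<open>x\<close> follows. The factor \<open>cmod (\<phi> z)\<close> remains because the
  derivative of the kernel carries \<open>cnj w\<close>.\<close>

lemma kernel_terms_bounded:
  defines "s \<equiv> (\<alpha> + 2) / p"
  shows "\<exists>K>0. AE z in dA_w \<beta>.
      cmod (u z * deriv \<phi> z) * cmod (\<phi> z) * (1 - (cmod (\<phi> z))\<^sup>2) powr (- s) \<le> K * g z \<and>
      cmod (deriv u z) * (1 - (cmod (\<phi> z))\<^sup>2) powr (1 - s) \<le> K * g z"
proof -
  obtain M0 :: nat where "s < real M0" using reals_Archimedean2 by blast
  then obtain M :: nat where M: "M \<ge> 1" "real M + 1 > s"
    using that[of "Suc M0"] by simp
  obtain K1 where K1: "K1 > 0" "AE z in dA_w \<beta>.
    cmod (deriv u z * of_real ((1 - (cmod (\<phi> z))\<^sup>2) powr (1 - s))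
      + u z * deriv \<phi> z * (of_nat M * cnj (\<phi> z) * of_real ((1 - (cmod (\<phi> z))\<^sup>2) powr (- s)))) \<le> K1 * g z"
    using test_power[of M] M unfolding s_def by auto
  obtain K2 where K2: "K2 > 0" "AE z in dA_w \<beta>.
    cmod (deriv u z * of_real ((1 - (cmod (\<phi> z))\<^sup>2) powr (1 - s))
      + u z * deriv \<phi> z * (of_nat (Suc M) * cnj (\<phi> z) * of_real ((1 - (cmod (\<phi> z))\<^sup>2) powr (- s)))) \<le> K2 * g z"
    using test_power[of "Suc M"] M unfolding s_def by auto
  define K where "K = K1 + M * (K1 + K2) + (K1 + K2)"
  have "AE z in dA_w \<beta>.
      cmod (u z * deriv \<phi> z) * cmod (\<phi> z) * (1 - (cmod (\<phi> z))\<^sup>2) powr (- s) \<le> K * g z \<and>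
      cmod (deriv u z) * (1 - (cmod (\<phi> z))\<^sup>2) powr (1 - s) \<le> K * g z"
    using K1(2) K2(2) test_const
  proof eventually_elim
    fix z
    let ?\<delta> = "1 - (cmod (\<phi> z))\<^sup>2"
    define x where "x = deriv u z * of_real (?\<delta> powr (1 - s))"
    define y where "y = u z * deriv \<phi> z * cnj (\<phi> z) * of_real (?\<delta> powr (- s))"
    assume "cmod (deriv u z * of_real (?\<delta> powr (1 - s))
      + u z * deriv \<phi> z * (of_nat M * cnj (\<phi> z) * of_real (?\<delta> powr (- s)))) \<le> K1 * g z"
    then have 1: "cmod (x + of_nat M * y) \<le> K1 * g z" by (simp add: x_def y_def mult_ac)
    assume "cmod (deriv u z * of_real (?\<delta> powr (1 - s))
      + u z * deriv \<phi> z * (of_nat (Suc M) * cnj (\<phi> z) * of_real (?\<delta> powr (- s)))) \<le> K2 * g z"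
    then have 2: "cmod (x + of_nat (Suc M) * y) \<le> K2 * g z" by (simp add: x_def y_def mult_ac)
    assume "cmod (deriv u z) \<le> g z"
    then have g: "g z \<ge> 0" by (rule order_trans[OF norm_ge_zero])
    have "y = (x + of_nat (Suc M) * y) - (x + of_nat M * y)" by (simp add: algebra_simps)
    then have y: "cmod y \<le> (K1 + K2) * g z"
      using norm_triangle_ineq4[of "x + of_nat (Suc M) * y" "x + of_nat M * y"] 1 2
      by (simp add: algebra_simps)
    have "x = (x + of_nat M * y) - of_nat M * y" by simp
    then have "cmod x \<le> cmod (x + of_nat M * y) + M * cmod y"
      using norm_triangle_ineq4[of "x + of_nat M * y" "of_nat M * y"] by (simp add: norm_mult)
    also have "\<dots> \<le> K1 * g z + M * ((K1 + K2) * g z)"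
      using 1 y by (intro add_mono mult_left_mono) auto
    also have "\<dots> \<le> K * g z" using g K1 K2 by (simp add: K_def algebra_simps)
    finally have "cmod x \<le> K * g z" .
    moreover have "cmod y \<le> K * g z"
    proof -
      have "K1 * g z + M * ((K1 + K2) * g z) \<ge> 0" using g K1 K2 by simp
      then show ?thesis using y by (simp add: K_def algebra_simps)
    qed
    ultimately show "cmod (u z * deriv \<phi> z) * cmod (\<phi> z) * ?\<delta> powr (- s) \<le> K * g z \<and>
      cmod (deriv u z) * ?\<delta> powr (1 - s) \<le> K * g z"
      by (simp add: x_def y_def norm_mult)
  qed
  then show ?thesis using K1 K2 by (intro exI[of _ K]) (auto simp: K_def intro!: add_pos_nonneg)
qed

text \<open>Where \<open>\<phi> z\<close> is close to \<open>0\<close> the kernels give nothing, and the test functions \<open>1\<close> and \<open>z\<close> take over.\<close>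

lemma composition_term_bounded:
  "\<exists>K>0. AE z in dA_w \<beta>. cmod (u z * deriv \<phi> z) * (1 - (cmod (\<phi> z))\<^sup>2) powr (- ((\<alpha> + 2) / p)) \<le> K * g z"
proof -
  define s where "s = (\<alpha> + 2) / p"
  have s: "s > 0" using \<alpha> p by (simp add: s_def)
  obtain K1 where K1: "K1 > 0" "AE z in dA_w \<beta>.
      cmod (u z * deriv \<phi> z) * cmod (\<phi> z) * (1 - (cmod (\<phi> z))\<^sup>2) powr (- s) \<le> K1 * g z \<and>
      cmod (deriv u z) * (1 - (cmod (\<phi> z))\<^sup>2) powr (1 - s) \<le> K1 * g z"
    using kernel_terms_bounded unfolding s_def by blast
  obtain K2 where K2: "K2 > 0" "AE z in dA_w \<beta>. cmod (deriv u z * \<phi> z + u z * deriv \<phi> z) \<le> K2 * g z"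
    using test_id by blast
  \<comment> \<open>The first part serves \<open>cmod (\<phi> z) \<ge> 1/2\<close>. Otherwise
    \<open>\<delta> \<ge> 3/4\<close>, and removing \<open>deriv u z * \<phi> z\<close> from the
    test with the identity raises \<open>K2\<close> by \<open>1\<close>.\<close>
  define K where "K = 2 * K1 + (3/4) powr (- s) * (K2 + 1)"
  have "AE z in dA_w \<beta>. z \<in> unit_disk" using AE_space[of "dA_w \<beta>"] by simp
  with K1(2) K2(2) test_const
  have "AE z in dA_w \<beta>. cmod (u z * deriv \<phi> z) * (1 - (cmod (\<phi> z))\<^sup>2) powr (- s) \<le> K * g z"
  proof eventually_elim
    fix z
    let ?\<delta> = "1 - (cmod (\<phi> z))\<^sup>2"
    let ?b = "cmod (u z * deriv \<phi> z)"
    assume 1: "?b * cmod (\<phi> z) * ?\<delta> powr (- s) \<le> K1 * g z \<and> cmod (deriv u z) * ?\<delta> powr (1 - s) \<le> K1 * g z"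
      and 2: "cmod (deriv u z * \<phi> z + u z * deriv \<phi> z) \<le> K2 * g z"
      and 3: "cmod (deriv u z) \<le> g z" and z: "z \<in> unit_disk"
    have g: "g z \<ge> 0" using 3 by (rule order_trans[OF norm_ge_zero])
    have "\<phi> z \<in> unit_disk" using self_map z by blast
    then have ph: "cmod (\<phi> z) < 1" by simp
    show "?b * ?\<delta> powr (- s) \<le> K * g z"
    proof (cases "cmod (\<phi> z) \<ge> 1/2")
      case True
      have "?b * ?\<delta> powr (- s) * 1 \<le> ?b * ?\<delta> powr (- s) * (2 * cmod (\<phi> z))"
        using True by (intro mult_left_mono) auto
      also have "\<dots> \<le> 2 * (K1 * g z)" using 1 by (simp add: mult_ac)
      also have "\<dots> \<le> K * g z"
        using g K2 mult_nonneg_nonneg[of "(3/4) powr (- s) * (K2 + 1)" "g z"] by (simp add: K_def algebra_simps)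
      finally show ?thesis by simp
    next
      case False
      have "(cmod (\<phi> z))\<^sup>2 \<le> (1/2)\<^sup>2" using False by (intro power_mono) auto
      then have "?\<delta> \<ge> 3/4" by (simp add: power2_eq_square)
      then have d: "?\<delta> powr (- s) \<le> (3/4) powr (- s)" using s by (intro powr_mono2') auto
      have "cmod (deriv u z) * cmod (\<phi> z) \<le> g z * 1" using 3 ph g by (intro mult_mono) auto
      then have "?b \<le> (K2 + 1) * g z"
        using 2 norm_triangle_ineq4[of "deriv u z * \<phi> z + u z * deriv \<phi> z" "deriv u z * \<phi> z"]
        by (simp add: norm_mult algebra_simps)
      then have "?b * ?\<delta> powr (- s) \<le> (K2 + 1) * g z * (3/4) powr (- s)"
        using d K2 g by (intro mult_mono) auto
      also have "\<dots> \<le> K * g z" using g K1 by (simp add: K_def algebra_simps)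
      finally show ?thesis .
    qed
  qed
  then show ?thesis using K1 K2 unfolding s_def
    by (intro exI[of _ K]) (auto simp: K_def intro!: add_pos_nonneg)
qed

text \<open>As \<open>L powr (-1/p)\<close> is bounded, the derivative term of the logarithmic test
  is dominated by the composition term with \<open>s = 1\<close>, known to be controlled by
  \<open>g\<close>. Subtracting it leaves the function term.\<close>

lemma log_term_bounded:
  assumes crit: "p = \<alpha> + 2"
  shows "\<exists>K>0. AE z in dA_w \<beta>. cmod (deriv u z) * ln (2 / (1 - (cmod (\<phi> z))\<^sup>2)) powr (1 - 1/p) \<le> K * g z"
proof -
  have s: "(\<alpha> + 2) / p = 1" using p crit by simp
  obtain K1 where K1: "K1 > 0"
    "AE z in dA_w \<beta>. cmod (u z * deriv \<phi> z) * (1 - (cmod (\<phi> z))\<^sup>2) powr (- 1) \<le> K1 * g z"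
    using composition_term_bounded unfolding s by blast
  obtain K2 where K2: "K2 > 0" "AE z in dA_w \<beta>.
    cmod (deriv u z * of_real (ln (2 / (1 - (cmod (\<phi> z))\<^sup>2)) powr (1 - 1/p))
      + u z * deriv \<phi> z * (of_real (ln (2 / (1 - (cmod (\<phi> z))\<^sup>2)) powr (-1/p)) * cnj (\<phi> z)
          / of_real (1 - (cmod (\<phi> z))\<^sup>2))) \<le> K2 * g z"
    using test_log[OF crit] by blast
  define K where "K = K2 + K1 * ln 2 powr (-1/p)"
  have "AE z in dA_w \<beta>. z \<in> unit_disk" using AE_space[of "dA_w \<beta>"] by simp
  with K1(2) K2(2)
  have "AE z in dA_w \<beta>. cmod (deriv u z) * ln (2 / (1 - (cmod (\<phi> z))\<^sup>2)) powr (1 - 1/p) \<le> K * g z"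
  proof eventually_elim
    fix z
    let ?\<delta> = "1 - (cmod (\<phi> z))\<^sup>2"
    define L where "L = ln (2 / ?\<delta>)"
    assume 1: "cmod (u z * deriv \<phi> z) * ?\<delta> powr (- 1) \<le> K1 * g z"
      and "cmod (deriv u z * of_real (ln (2 / ?\<delta>) powr (1 - 1/p))
      + u z * deriv \<phi> z * (of_real (ln (2 / ?\<delta>) powr (-1/p)) * cnj (\<phi> z) / of_real ?\<delta>)) \<le> K2 * g z"
      and z: "z \<in> unit_disk"
    define x where "x = deriv u z * of_real (L powr (1 - 1/p))"
    define y where "y = u z * deriv \<phi> z * (of_real (L powr (-1/p)) * cnj (\<phi> z) / of_real ?\<delta>)"
    have 2: "cmod (x + y) \<le> K2 * g z"
      unfolding x_def y_def L_def by fact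
    have "\<phi> z \<in> unit_disk" using self_map z by blast
    then have ph: "cmod (\<phi> z) < 1" by simp
    have \<delta>: "0 < ?\<delta>" "?\<delta> \<le> 1" using one_minus_cmod_bounds[of "\<phi> z"] ph by auto
    have "ln 2 \<le> L" unfolding L_def using \<delta> by (subst ln_le_cancel_iff) (auto simp: field_simps)
    then have Lp: "L powr (-1/p) \<le> ln 2 powr (-1/p)" using p by (intro powr_mono2') auto
    have "cmod y = (cmod (u z * deriv \<phi> z) * ?\<delta> powr (- 1)) * (L powr (-1/p) * cmod (\<phi> z))"
      using \<delta> by (simp add: y_def norm_mult norm_divide norm_inverse powr_minus divide_inverse flip: of_real_diff of_real_power)
    also have "\<dots> \<le> (K1 * g z) * (ln 2 powr (-1/p) * 1)"
    proof (rule mult_mono[OF 1])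
      show "L powr (-1/p) * cmod (\<phi> z) \<le> ln 2 powr (-1/p) * 1" using Lp ph by (intro mult_mono) auto
      show "0 \<le> K1 * g z" by (rule order_trans[OF _ 1]) simp
    qed simp
    finally have "cmod x \<le> K2 * g z + (K1 * g z) * (ln 2 powr (-1/p) * 1)"
      using norm_triangle_ineq4[of "x + y" y] 2 by simp
    then show "cmod (deriv u z) * ln (2 / ?\<delta>) powr (1 - 1/p) \<le> K * g z"
      by (simp add: x_def L_def[symmetric] norm_mult K_def algebra_simps)
  qed
  then show ?thesis using K1 K2 by (intro exI[of _ K]) (auto simp: K_def intro!: add_pos_nonneg)
qed

end

section \<open>Sufficiency and the three equivalences\<close>

lemma nn_integral_powr_finite_of_AE_le:
  assumes "q > 0" "K > 0" and g: "g \<in> borel_measurable (dA_w \<beta>)" "finite_int \<beta> (\<lambda>z. \<bar>g z\<bar> powr q)"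
    and le: "AE z in dA_w \<beta>. F z \<le> K * g z" and F: "\<And>z. 0 \<le> F z"
  shows "(\<integral>\<^sup>+ z. ennreal (F z powr q) \<partial>dA_w \<beta>) < \<infinity>"
proof -
  have "(\<integral>\<^sup>+ z. ennreal (F z powr q) \<partial>dA_w \<beta>)
      \<le> (\<integral>\<^sup>+ z. ennreal (K powr q) * ennreal (\<bar>g z\<bar> powr q) \<partial>dA_w \<beta>)"
  proof (rule nn_integral_mono_AE)
    show "AE z in dA_w \<beta>. ennreal (F z powr q) \<le> ennreal (K powr q) * ennreal (\<bar>g z\<bar> powr q)"
      using le
    proof eventually_elim
      fix z assume "F z \<le> K * g z"
      also have "\<dots> \<le> K * \<bar>g z\<bar>" using assms(2) by simp
      finally have "F z powr q \<le> (K * \<bar>g z\<bar>) powr q" using F assms(1) by (intro powr_mono2) auto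
      then have "ennreal (F z powr q) \<le> ennreal (K powr q * \<bar>g z\<bar> powr q)"
        by (intro ennreal_leI) (simp add: powr_mult)
      then show "ennreal (F z powr q) \<le> ennreal (K powr q) * ennreal (\<bar>g z\<bar> powr q)"
        by (simp add: ennreal_mult')
    qed
  qed
  also have "\<dots> = ennreal (K powr q) * (\<integral>\<^sup>+ z. ennreal (\<bar>g z\<bar> powr q) \<partial>dA_w \<beta>)"
    using g(1) by (intro nn_integral_cmult) measurable
  also have "\<dots> < \<infinity>" using g(2) by (simp add: finite_int_def ennreal_mult_less_top)
  finally show ?thesis .
qed

text \<open>If \<open>A\<close> and \<open>B\<close> dominate functions and derivatives on the unit
  ball, the triangle inequality makes \<open>a * x + b * y\<close> a bound at every point of the
  disk; continuity of \<open>A\<close> and \<open>B\<close> makes it measurable.\<close>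

lemma order_boundedI:
  fixes A B :: "complex \<Rightarrow> real"
  assumes q: "q > 0"
    and u: "u holomorphic_on unit_disk"
    and \<phi>: "\<phi> holomorphic_on unit_disk" "\<phi> ` unit_disk \<subseteq> unit_disk"
    and A: "continuous_on unit_disk A" "\<And>w. w \<in> unit_disk \<Longrightarrow> A w \<ge> 0" "a > 0"
      "\<And>f w. f \<in> dirichlet_space p \<alpha> \<Longrightarrow> dirichlet_norm p \<alpha> f \<le> 1 \<Longrightarrow> w \<in> unit_disk \<Longrightarrow> cmod (f w) \<le> a * A w"
    and B: "continuous_on unit_disk B" "\<And>w. w \<in> unit_disk \<Longrightarrow> B w \<ge> 0" "b > 0"
      "\<And>f w. f \<in> dirichlet_space p \<alpha> \<Longrightarrow> dirichlet_norm p \<alpha> f \<le> 1 \<Longrightarrow> w \<in> unit_disk \<Longrightarrow> cmod (deriv f w) \<le> b * B w"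
    and fin: "(\<integral>\<^sup>+ z. ennreal ((cmod (u z * deriv \<phi> z) * B (\<phi> z)) powr q) \<partial>dA_w \<beta>) < \<infinity>"
      "(\<integral>\<^sup>+ z. ennreal ((cmod (deriv u z) * A (\<phi> z)) powr q) \<partial>dA_w \<beta>) < \<infinity>"
  shows "order_bounded p \<alpha> q \<beta> u \<phi>"
proof -
  define x where "x z = cmod (deriv u z) * A (\<phi> z)" for z
  define y where "y z = cmod (u z * deriv \<phi> z) * B (\<phi> z)" for z
  define g where "g z = a * x z + b * y z" for z
  have ph: "\<phi> z \<in> unit_disk" if "z \<in> unit_disk" for z using \<phi>(2) that by blast
  have du: "deriv u holomorphic_on unit_disk" and dph: "deriv \<phi> holomorphic_on unit_disk"
    using u \<phi> by (auto intro: holomorphic_deriv)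
  have cA: "continuous_on unit_disk (\<lambda>z. A (\<phi> z))" and cB: "continuous_on unit_disk (\<lambda>z. B (\<phi> z))"
    using A(1) B(1) \<phi>(2) holomorphic_on_imp_continuous_on[OF \<phi>(1)]
    by (auto intro: continuous_on_compose2)
  have "continuous_on unit_disk x" "continuous_on unit_disk y"
    unfolding x_def y_def
    using holomorphic_on_imp_continuous_on[OF u] holomorphic_on_imp_continuous_on[OF du]
      holomorphic_on_imp_continuous_on[OF dph] by (intro continuous_intros cA cB; simp)+
  then have xm: "x \<in> borel_measurable (dA_w \<beta>)" and ym: "y \<in> borel_measurable (dA_w \<beta>)"
    by (auto intro: measurable_dA_w_continuous)
  have xy: "x z \<ge> 0" "y z \<ge> 0" if "z \<in> unit_disk" for z
    using A(2) B(2) ph[OF that] by (auto simp: x_def y_def)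
  have gm: "g \<in> borel_measurable (dA_w \<beta>)" unfolding g_def using xm ym by measurable
  have "(\<integral>\<^sup>+ z. ennreal (\<bar>g z\<bar> powr q) \<partial>dA_w \<beta>)
      \<le> (\<integral>\<^sup>+ z. ennreal ((2 * a) powr q) * ennreal (x z powr q) + ennreal ((2 * b) powr q) * ennreal (y z powr q) \<partial>dA_w \<beta>)"
  proof (rule nn_integral_mono)
    fix z assume "z \<in> space (dA_w \<beta>)"
    then have nonneg: "x z \<ge> 0" "y z \<ge> 0" using xy by auto
    \<comment> \<open>Comparing the sum with twice its larger term works for \<open>q < 1\<close>
      and \<open>q \<ge> 1\<close> alike.\<close>
    have "\<bar>g z\<bar> powr q \<le> (2 * a * x z) powr q + (2 * b * y z) powr q"
    proof (cases "a * x z \<le> b * y z")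
      case True
      then have "\<bar>g z\<bar> \<le> 2 * b * y z" using nonneg A(3) B(3) by (simp add: g_def)
      then have "\<bar>g z\<bar> powr q \<le> (2 * b * y z) powr q" using q by (intro powr_mono2) auto
      then show ?thesis by (simp add: add_increasing)
    next
      case False
      then have "\<bar>g z\<bar> \<le> 2 * a * x z" using nonneg A(3) B(3) by (simp add: g_def)
      then have "\<bar>g z\<bar> powr q \<le> (2 * a * x z) powr q" using q by (intro powr_mono2) auto
      then show ?thesis by (simp add: add_increasing2)
    qed
    then have "ennreal (\<bar>g z\<bar> powr q) \<le> ennreal ((2 * a) powr q * x z powr q + (2 * b) powr q * y z powr q)"
      by (intro ennreal_leI) (simp add: powr_mult)
    then show "ennreal (\<bar>g z\<bar> powr q) \<le> ennreal ((2 * a) powr q) * ennreal (x z powr q) + ennreal ((2 * b) powr q) * ennreal (y z powr q)"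
      by (simp add: ennreal_mult' ennreal_plus)
  qed
  also have "\<dots> = ennreal ((2 * a) powr q) * (\<integral>\<^sup>+ z. ennreal (x z powr q) \<partial>dA_w \<beta>)
      + ennreal ((2 * b) powr q) * (\<integral>\<^sup>+ z. ennreal (y z powr q) \<partial>dA_w \<beta>)"
    using xm ym by (simp add: nn_integral_add nn_integral_cmult)
  also have "\<dots> < \<infinity>"
    using fin by (simp add: x_def y_def ennreal_mult_less_top)
  finally have gfin: "finite_int \<beta> (\<lambda>z. \<bar>g z\<bar> powr q)" by (simp add: finite_int_def)
  have "AE z in dA_w \<beta>. cmod (deriv (wcomp u \<phi> f) z) \<le> g z"
    if f: "f \<in> dirichlet_space p \<alpha>" "dirichlet_norm p \<alpha> f \<le> 1" for f
  proof (rule AE_I2)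
    fix z assume "z \<in> space (dA_w \<beta>)"
    then have z: "z \<in> unit_disk" by simp
    have "f holomorphic_on unit_disk" using dirichlet_holomorphic[OF f(1)] by simp
    then have "(f has_field_derivative deriv f (\<phi> z)) (at (\<phi> z))"
      using ph[OF z] by (auto intro: holomorphic_derivI)
    then have "cmod (deriv (wcomp u \<phi> f) z) = cmod (deriv u z * f (\<phi> z) + u z * deriv \<phi> z * deriv f (\<phi> z))"
      by (subst deriv_wcomp[OF u \<phi> z]) auto
    also have "\<dots> \<le> cmod (deriv u z) * cmod (f (\<phi> z)) + cmod (u z * deriv \<phi> z) * cmod (deriv f (\<phi> z))"
      by (metis norm_triangle_ineq norm_mult)
    also have "\<dots> \<le> cmod (deriv u z) * (a * A (\<phi> z)) + cmod (u z * deriv \<phi> z) * (b * B (\<phi> z))"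
      by (intro add_mono mult_left_mono A(4) B(4) f ph z) auto
    also have "\<dots> = g z" by (simp add: g_def x_def y_def mult_ac)
    finally show "cmod (deriv (wcomp u \<phi> f) z) \<le> g z" .
  qed
  then show ?thesis unfolding order_bounded_def using gm gfin by blast
qed

text \<open>Turns the quotients of the theorem into \<open>q\<close>-th powers of a growth rate. The
  base \<open>d\<close> is \<open>\<delta>\<close> or its logarithm, and the equation between
  exponents lets each case supply its own \<open>t\<close>.\<close>

lemma weight_quotient:
  fixes d :: real
  assumes "x \<ge> 0" "d > 0" "q * r / p = q * t"
  shows "x powr q / d powr (q * r / p) = (x * d powr (- t)) powr q"
proof -
  have "(d powr (- t)) powr q = d powr (- (q * t))" by (simp add: powr_powr mult.commute)
  then show ?thesis unfolding assms(3) by (simp add: powr_mult powr_minus divide_inverse)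
qed

theorem theorem2p3:
  fixes \<alpha> \<beta> p q :: real and u \<phi> :: "complex \<Rightarrow> complex"
  assumes "\<alpha> > -1" and "\<beta> > -1" and "0 < p" and "0 < q"
    and "u holomorphic_on unit_disk"
    and "\<phi> holomorphic_on unit_disk" and "\<phi> ` unit_disk \<subseteq> unit_disk"
  shows
   "(p < \<alpha> + 2 \<longrightarrow>
      (order_bounded p \<alpha> q \<beta> u \<phi> \<longleftrightarrow>
        (\<integral>\<^sup>+ z. ennreal (cmod (u z * deriv \<phi> z) powr q
                    / (1 - (cmod (\<phi> z))\<^sup>2) powr (q * (\<alpha> + 2) / p)) \<partial>dA_w \<beta>)
      + (\<integral>\<^sup>+ z. ennreal (cmod (deriv u z) powr q
                    / (1 - (cmod (\<phi> z))\<^sup>2) powr (q * (\<alpha> + 2 - p) / p)) \<partial>dA_w \<beta>) < \<infinity>))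
  \<and> (p = \<alpha> + 2 \<longrightarrow>
      (order_bounded p \<alpha> q \<beta> u \<phi> \<longleftrightarrow>
        (\<integral>\<^sup>+ z. ennreal (cmod (u z * deriv \<phi> z) powr q
                    / (1 - (cmod (\<phi> z))\<^sup>2) powr q) \<partial>dA_w \<beta>)
      + (\<integral>\<^sup>+ z. ennreal (cmod (deriv u z) powr q
                    / (ln (2 / (1 - (cmod (\<phi> z))\<^sup>2))) powr (q * (1 - p) / p)) \<partial>dA_w \<beta>) < \<infinity>))
  \<and> (p > \<alpha> + 2 \<longrightarrow>
      (order_bounded p \<alpha> q \<beta> u \<phi> \<longleftrightarrow>
        u \<in> dirichlet_space q \<beta> \<and>
        finite_int \<beta> (\<lambda>z. cmod (u z * deriv \<phi> z) powr q
                    / (1 - (cmod (\<phi> z))\<^sup>2) powr (q * (\<alpha> + 2) / p))))"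
proof -
  define s where "s = (\<alpha> + 2) / p"
  have \<delta>: "0 < 1 - (cmod w)\<^sup>2" "1 - (cmod w)\<^sup>2 \<le> 1" if "w \<in> unit_disk" for w :: complex
    using one_minus_cmod_bounds[of w] that by auto
  have ph: "\<phi> z \<in> unit_disk" if "z \<in> unit_disk" for z using assms(7) that by blast
  define X where "X = (\<integral>\<^sup>+ z. ennreal ((cmod (u z * deriv \<phi> z) * (1 - (cmod (\<phi> z))\<^sup>2) powr (- s)) powr q) \<partial>dA_w \<beta>)"
  have X: "(\<integral>\<^sup>+ z. ennreal (cmod (u z * deriv \<phi> z) powr q
      / (1 - (cmod (\<phi> z))\<^sup>2) powr (q * (\<alpha> + 2) / p)) \<partial>dA_w \<beta>) = X"
    unfolding X_def using \<delta>[OF ph]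
    by (intro nn_integral_cong arg_cong[where f = ennreal] weight_quotient) (auto simp: s_def)
  have contd: "continuous_on unit_disk (\<lambda>w::complex. (1 - (cmod w)\<^sup>2) powr t)" for t
    using \<delta> by (intro continuous_intros) (auto simp: less_imp_neq[symmetric])
  obtain b where b: "b > 0" "\<And>f w. f \<in> dirichlet_space p \<alpha> \<Longrightarrow> dirichlet_norm p \<alpha> f \<le> 1 \<Longrightarrow> w \<in> unit_disk \<Longrightarrow>
      cmod (deriv f w) \<le> b * (1 - (cmod w)\<^sup>2) powr (- s)"
    using deriv_growth[OF assms(3), of \<alpha>] unfolding s_def minus_divide_left by blast
  \<comment> \<open>The majorant of the derivative is the same in all cases; only the majorant
    \<open>A\<close> of the function distinguishes them.\<close>
  have sufficient: "order_bounded p \<alpha> q \<beta> u \<phi>"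
    if "continuous_on unit_disk A" "\<And>w. w \<in> unit_disk \<Longrightarrow> A w \<ge> 0" "a > 0"
      "\<And>f w. f \<in> dirichlet_space p \<alpha> \<Longrightarrow> dirichlet_norm p \<alpha> f \<le> 1 \<Longrightarrow> w \<in> unit_disk \<Longrightarrow> cmod (f w) \<le> a * A w"
      "X < \<infinity>" "(\<integral>\<^sup>+ z. ennreal ((cmod (deriv u z) * A (\<phi> z)) powr q) \<partial>dA_w \<beta>) < \<infinity>" for A a
    using that by (intro order_boundedI[OF assms(4-7) _ _ _ _ contd _ b _, where A = A and a = a]) (auto simp: X_def)
  have necessary: "\<exists>g. order_bound_witness p \<alpha> \<beta> u \<phi> g \<and> g \<in> borel_measurable (dA_w \<beta>) \<and> finite_int \<beta> (\<lambda>z. \<bar>g z\<bar> powr q)"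
    if "order_bounded p \<alpha> q \<beta> u \<phi>"
    using that assms unfolding order_bounded_def order_bound_witness_def by blast
  have X_fin: "X < \<infinity>" if ob: "order_bounded p \<alpha> q \<beta> u \<phi>"
  proof -
    obtain g where g: "order_bound_witness p \<alpha> \<beta> u \<phi> g" "g \<in> borel_measurable (dA_w \<beta>)" "finite_int \<beta> (\<lambda>z. \<bar>g z\<bar> powr q)"
      using necessary[OF ob] by blast
    obtain K where "K > 0" "AE z in dA_w \<beta>. cmod (u z * deriv \<phi> z) * (1 - (cmod (\<phi> z))\<^sup>2) powr (- s) \<le> K * g z"
      using order_bound_witness.composition_term_bounded[OF g(1)] unfolding s_def by blast
    then show ?thesis unfolding X_def
      by (intro nn_integral_powr_finite_of_AE_le[OF assms(4) _ g(2,3)]) auto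
  qed
  have case1: "order_bounded p \<alpha> q \<beta> u \<phi> \<longleftrightarrow> X +
      (\<integral>\<^sup>+ z. ennreal (cmod (deriv u z) powr q / (1 - (cmod (\<phi> z))\<^sup>2) powr (q * (\<alpha> + 2 - p) / p)) \<partial>dA_w \<beta>) < \<infinity>"
    if p: "p < \<alpha> + 2"
  proof -
    define Y where "Y = (\<integral>\<^sup>+ z. ennreal ((cmod (deriv u z) * (1 - (cmod (\<phi> z))\<^sup>2) powr (1 - s)) powr q) \<partial>dA_w \<beta>)"
    have e: "q * (\<alpha> + 2 - p) / p = q * (s - 1)" using assms(3) by (simp add: s_def field_simps)
    have Y: "(\<integral>\<^sup>+ z. ennreal (cmod (deriv u z) powr q / (1 - (cmod (\<phi> z))\<^sup>2) powr (q * (\<alpha> + 2 - p) / p)) \<partial>dA_w \<beta>) = Y"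
      unfolding Y_def using \<delta>[OF ph] weight_quotient[OF _ _ e]
      by (intro nn_integral_cong arg_cong[where f = ennreal]) simp
    obtain a where a: "a > 0" "\<And>f w. f \<in> dirichlet_space p \<alpha> \<Longrightarrow> dirichlet_norm p \<alpha> f \<le> 1 \<Longrightarrow> w \<in> unit_disk \<Longrightarrow>
        cmod (f w) \<le> a * (1 - (cmod w)\<^sup>2) powr (1 - s)"
      using growth_power[OF assms(3,1) p] unfolding s_def by blast
    have "order_bounded p \<alpha> q \<beta> u \<phi>" if "X < \<infinity>" "Y < \<infinity>"
      using that a unfolding Y_def
      by (intro sufficient[of "\<lambda>w. (1 - (cmod w)\<^sup>2) powr (1 - s)" a] contd) auto
    moreover have "Y < \<infinity>" if ob: "order_bounded p \<alpha> q \<beta> u \<phi>"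
    proof -
      obtain g where g: "order_bound_witness p \<alpha> \<beta> u \<phi> g" "g \<in> borel_measurable (dA_w \<beta>)" "finite_int \<beta> (\<lambda>z. \<bar>g z\<bar> powr q)"
        using necessary[OF ob] by blast
      obtain K where "K > 0" "AE z in dA_w \<beta>. cmod (deriv u z) * (1 - (cmod (\<phi> z))\<^sup>2) powr (1 - s) \<le> K * g z"
        using order_bound_witness.kernel_terms_bounded[OF g(1)] unfolding s_def by auto
      then show ?thesis unfolding Y_def
        by (intro nn_integral_powr_finite_of_AE_le[OF assms(4) _ g(2,3)]) auto
    qed
    ultimately show ?thesis using X_fin unfolding Y by (auto simp: less_top)
  qed
  have case2: "order_bounded p \<alpha> q \<beta> u \<phi> \<longleftrightarrow>
        (\<integral>\<^sup>+ z. ennreal (cmod (u z * deriv \<phi> z) powr q / (1 - (cmod (\<phi> z))\<^sup>2) powr q) \<partial>dA_w \<beta>)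
      + (\<integral>\<^sup>+ z. ennreal (cmod (deriv u z) powr q / (ln (2 / (1 - (cmod (\<phi> z))\<^sup>2))) powr (q * (1 - p) / p)) \<partial>dA_w \<beta>) < \<infinity>"
    if p: "p = \<alpha> + 2"
  proof -
    \<comment> \<open>At the critical exponent \<open>s = 1\<close>, so the first integral of this
      case is \<open>X\<close> again.\<close>
    have "q * (\<alpha> + 2) / p = q" using p assms(3) by simp
    note X2 = X[unfolded this]
    have L: "0 < ln (2 / (1 - (cmod w)\<^sup>2))" if "w \<in> unit_disk" for w :: complex
      using \<delta>[OF that] by (intro ln_gt_zero) (simp add: field_simps add_pos_nonneg)
    define Y where "Y = (\<integral>\<^sup>+ z. ennreal ((cmod (deriv u z) * ln (2 / (1 - (cmod (\<phi> z))\<^sup>2)) powr (1 - 1/p)) powr q) \<partial>dA_w \<beta>)"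
    \<comment> \<open>Here \<open>p > 1\<close>, so this exponent is negative and the division
      multiplies by the growth rate of \<open>f\<close>.\<close>
    have e: "q * (1 - p) / p = q * (1/p - 1)" using assms(3) by (simp add: field_simps)
    have Y: "(\<integral>\<^sup>+ z. ennreal (cmod (deriv u z) powr q / (ln (2 / (1 - (cmod (\<phi> z))\<^sup>2))) powr (q * (1 - p) / p)) \<partial>dA_w \<beta>) = Y"
      unfolding Y_def using L[OF ph] weight_quotient[OF _ _ e]
      by (intro nn_integral_cong arg_cong[where f = ennreal]) simp
    obtain a where a: "a > 0" "\<And>f w. f \<in> dirichlet_space p \<alpha> \<Longrightarrow> dirichlet_norm p \<alpha> f \<le> 1 \<Longrightarrow> w \<in> unit_disk \<Longrightarrow>
        cmod (f w) \<le> a * ln (2 / (1 - (cmod w)\<^sup>2)) powr (1 - 1/p)"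
      using growth_log[OF assms(1) p] by blast
    have "continuous_on unit_disk (\<lambda>w::complex. ln (2 / (1 - (cmod w)\<^sup>2)))"
      using \<delta> by (intro continuous_intros) (auto simp: less_imp_neq[symmetric])
    then have cL: "continuous_on unit_disk (\<lambda>w::complex. ln (2 / (1 - (cmod w)\<^sup>2)) powr (1 - 1/p))"
      by (rule continuous_on_powr[OF _ continuous_on_const]) (use L in force)
    have "order_bounded p \<alpha> q \<beta> u \<phi>" if "X < \<infinity>" "Y < \<infinity>"
      using that a unfolding Y_def
      by (intro sufficient[of "\<lambda>w. ln (2 / (1 - (cmod w)\<^sup>2)) powr (1 - 1/p)" a] cL) auto
    moreover have "Y < \<infinity>" if ob: "order_bounded p \<alpha> q \<beta> u \<phi>"
    proof -
      obtain g where g: "order_bound_witness p \<alpha> \<beta> u \<phi> g" "g \<in> borel_measurable (dA_w \<beta>)" "finite_int \<beta> (\<lambda>z. \<bar>g z\<bar> powr q)"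
        using necessary[OF ob] by blast
      obtain K where "K > 0" "AE z in dA_w \<beta>. cmod (deriv u z) * ln (2 / (1 - (cmod (\<phi> z))\<^sup>2)) powr (1 - 1/p) \<le> K * g z"
        using order_bound_witness.log_term_bounded[OF g(1) p] by blast
      then show ?thesis unfolding Y_def
        by (intro nn_integral_powr_finite_of_AE_le[OF assms(4) _ g(2,3)]) auto
    qed
    ultimately show ?thesis using X_fin unfolding X2 Y by (auto simp: less_top)
  qed
  have case3: "order_bounded p \<alpha> q \<beta> u \<phi> \<longleftrightarrow> u \<in> dirichlet_space q \<beta> \<and> X < \<infinity>" if p: "p > \<alpha> + 2"
  proof -
    obtain a where a: "a > 0" "\<And>f w. f \<in> dirichlet_space p \<alpha> \<Longrightarrow> dirichlet_norm p \<alpha> f \<le> 1 \<Longrightarrow> w \<in> unit_disk \<Longrightarrow> cmod (f w) \<le> a"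
      using growth_bounded[OF assms(1) p] by blast
    have du: "u \<in> dirichlet_space q \<beta> \<longleftrightarrow> (\<integral>\<^sup>+ z. ennreal (cmod (deriv u z) powr q) \<partial>dA_w \<beta>) < \<infinity>"
      using assms(5) by (simp add: dirichlet_space_def finite_int_def)
    \<comment> \<open>Bounded functions have the majorant \<open>1\<close>, and the second integral
      becomes the energy of \<open>u\<close>.\<close>
    have "order_bounded p \<alpha> q \<beta> u \<phi>" if "X < \<infinity>" "u \<in> dirichlet_space q \<beta>"
      using that a unfolding du by (intro sufficient[of "\<lambda>_. 1" a]) auto
    moreover have "u \<in> dirichlet_space q \<beta>" if ob: "order_bounded p \<alpha> q \<beta> u \<phi>"
    proof -
      obtain g where g: "order_bound_witness p \<alpha> \<beta> u \<phi> g" "g \<in> borel_measurable (dA_w \<beta>)" "finite_int \<beta> (\<lambda>z. \<bar>g z\<bar> powr q)"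
        using necessary[OF ob] by blast
      show ?thesis unfolding du
        using order_bound_witness.test_const[OF g(1)]
        by (intro nn_integral_powr_finite_of_AE_le[OF assms(4) zero_less_one g(2,3)]) auto
    qed
    ultimately show ?thesis using X_fin by blast
  qed
  show ?thesis
    using case1 case2 case3 unfolding finite_int_def X by blast
qed

end
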